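(* Let $q$ be a real locally integrable function on $\mathbb{R}$ such that the operator $\mathbb{L}_q=-\partial_x^2+q(x)$ is semibounded below, and such that for a.e. real $k$ the equation $\mathbb{L}_qu=k^2u$ has a right Jost solution $\psi(x,k)$, i.e. $\psi(x,k)\sim e^{\mathrm{i}kx}$, $\psi'(x,k)\sim \mathrm{i}ke^{\mathrm{i}kx}$ as $x\to+\infty$. Let $R(k)$ be the right reflection coefficient. Let $0<\omega_1,\dots,\omega_N$ ($N<\infty$) be distinct and suppose: 1. (Resonance condition) for each $1\le n\le N$, the equation $\mathbb{L}_qu=\omega_n^2u$ has a unique (up to a scalar multiple) solution in $L^2(-\infty)$; 2. (Continuity condition) $\psi(x,k)$ and $R(k)$ are continuous (in real $k$) at each $k=\omega_n$. Let $\alpha_1,\dots,\alpha_N$ be arbitrary nonzero real numbers and set $$\phi_n(x):=2\operatorname{Re}\big[R(\omega_n)^{1/2}\psi(x,\omega_n)\big],\quad 1\le n\le N,$$ with the square root taken with argument in $(-\pi,\pi]$. Then: (i) each $\phi_n\in L^2(-\infty)$; (ii) consequently the $N\times N$ matrix $\mathbf{G}_+(x)$ with entries $(\mathbf{G}_+(x))_{mn}=\alpha_m\alpha_n\int_{-\infty}^x\phi_m(s)\phi_n(s)\,\mathrm{d}s$ is well defined and positive semidefinite; (iii) the potential $q_{+N}(x)=q(x)-2\partial_x^2\log\det(\mathbf{I}+\mathbf{G}_+(x))$ has embedded eigenvalues (embedded bound states) at $\omega_n^2$, $1\le n\le N$; (iv) the associated eigenfunctions $y_1,\dots,y_N$ of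 $-\partial_x^2+q_{+N}$ (orthogonal in $L^2(\mathbb{R})$) are uniquely determined by the linear system $\mathbf{y}(x)(\mathbf{I}+\mathbf{G}_+(x))=-\big(\alpha_1\phi_1(x),\dots,\alpha_N\phi_N(x)\big)$, where $\mathbf{y}=(y_1,\dots,y_N)$ is a row vector; i.e. $y_n(x)+\sum_{m=1}^N y_m(x)\,\alpha_m\alpha_n\int_{-\infty}^x\phi_m\phi_n\,\mathrm{d}s=-\alpha_n\phi_n(x)$.
   Context: $L^2(\pm\infty)$ means $L^2(a,\pm\infty)$ for any finite $a$. Under the hypotheses, $q$ is in the limit point case at $\pm\infty$; for real $k$ let $\varphi(x,k)$ denote the boundary value on the real axis of the left Weyl solution (a solution of $\mathbb{L}_qu=k^2u$ lying in $L^2(-\infty)$ for $\operatorname{Im}k>0$). The right reflection coefficient is defined for a.e. real $k$ by $R(k)=-W(\varphi(x,k),\overline{\psi(x,k)})/W(\varphi(x,k),\psi(x,k))$ (independent of the normalization of $\varphi$); equivalently $\varphi$ can be normalized so that $\varphi(x,k)=\overline{\psi(x,k)}+R(k)\psi(x,k)$. Here $W(f,g)=fg'-f'g$. An embedded eigenvalue is a positive eigenvalue of the selfadjoint operator on $L^2(\mathbb{R})$ (it lies in the continuous spectrum). *)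

theory Defs
  imports "HOL-Analysis.Analysis"
begin

text \<open>Solutions of L_q u = lam u, with L_q = -d^2/dx^2 + q, in the Caratheodory sense
  (q is only locally integrable): u is differentiable with derivative u', and u' is an
  indefinite integral of (q - lam) u.\<close>
definition is_sol :: "(real \<Rightarrow> real) \<Rightarrow> complex \<Rightarrow> (real \<Rightarrow> complex) \<Rightarrow> bool" where
  "is_sol q lam u \<longleftrightarrow>
     (\<exists>u'. (\<forall>x. (u has_vector_derivative u' x) (at x)) \<and>
           (\<forall>a b. a \<le> b \<longrightarrow>
              ((\<lambda>s. (complex_of_real (q s) - lam) * u s) has_integral (u' b - u' a)) {a..b}))"

definition loc_integrable :: "(real \<Rightarrow> real) \<Rightarrow> bool" where
  "loc_integrable q \<longleftrightarrow> (\<forall>a b. q absolutely_integrable_on {a..b})"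

definition semibounded :: "(real \<Rightarrow> real) \<Rightarrow> bool" where
  "semibounded q \<longleftrightarrow>
     (\<exists>C. \<forall>(u::real \<Rightarrow> real) a b. u C1_differentiable_on UNIV \<longrightarrow>
          (\<forall>x. x \<notin> {a<..<b} \<longrightarrow> u x = 0) \<longrightarrow>
          C * integral {a..b} (\<lambda>x. (u x)\<^sup>2)
            \<le> integral {a..b} (\<lambda>x. (vector_derivative u (at x))\<^sup>2 + q x * (u x)\<^sup>2))"

definition L2_left :: "(real \<Rightarrow> 'a::real_normed_vector) \<Rightarrow> bool" where
  "L2_left f \<longleftrightarrow> f \<in> borel_measurable lborel \<and>
     (\<forall>a. set_integrable lborel {..a} (\<lambda>x. (norm (f x))\<^sup>2))"

definition L2_real :: "(real \<Rightarrow> 'a::real_normed_vector) \<Rightarrow> bool" where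
  "L2_real f \<longleftrightarrow> f \<in> borel_measurable lborel \<and> integrable lborel (\<lambda>x. (norm (f x))\<^sup>2)"

definition jost :: "(real \<Rightarrow> real) \<Rightarrow> (real \<Rightarrow> real \<Rightarrow> complex) \<Rightarrow> real \<Rightarrow> bool" where
  "jost q \<psi> k \<longleftrightarrow> is_sol q (complex_of_real (k\<^sup>2)) (\<lambda>x. \<psi> x k) \<and>
     ((\<lambda>x. \<psi> x k / cis (k * x)) \<longlongrightarrow> 1) at_top \<and>
     ((\<lambda>x. vector_derivative (\<lambda>t. \<psi> t k) (at x) / cis (k * x)) \<longlongrightarrow> \<i> * complex_of_real k) at_top"

definition weyl_left :: "(real \<Rightarrow> real) \<Rightarrow> complex \<Rightarrow> (real \<Rightarrow> complex) \<Rightarrow> bool" where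
  "weyl_left q z u \<longleftrightarrow> is_sol q (z\<^sup>2) u \<and> L2_left u \<and> u \<noteq> (\<lambda>_. 0)"

text \<open>phi is a boundary value on the real axis (at real k) of the left Weyl solution:
  suitably normalized Weyl solutions at k + i eps converge pointwise to phi (nontrivial)
  as eps tends to 0+.\<close>
definition left_weyl_bv :: "(real \<Rightarrow> real) \<Rightarrow> real \<Rightarrow> (real \<Rightarrow> complex) \<Rightarrow> bool" where
  "left_weyl_bv q k \<phi> \<longleftrightarrow> \<phi> \<noteq> (\<lambda>_. 0) \<and>
     (\<exists>\<Phi> :: real \<Rightarrow> real \<Rightarrow> complex.
        (\<forall>\<^sub>F \<epsilon> in at_right 0. weyl_left q (complex_of_real k + \<i> * complex_of_real \<epsilon>) (\<Phi> \<epsilon>)) \<and>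
        (\<forall>x. ((\<lambda>\<epsilon>. \<Phi> \<epsilon> x) \<longlongrightarrow> \<phi> x) (at_right 0)))"

text \<open>Wronskian W(f,g) = f g' - f' g (constant for solutions; evaluated at x = 0).\<close>
definition wronsk :: "(real \<Rightarrow> complex) \<Rightarrow> (real \<Rightarrow> complex) \<Rightarrow> complex" where
  "wronsk f g = f 0 * vector_derivative g (at 0) - vector_derivative f (at 0) * g 0"

definition refl :: "(real \<Rightarrow> real) \<Rightarrow> (real \<Rightarrow> real \<Rightarrow> complex) \<Rightarrow> real \<Rightarrow> complex" where
  "refl q \<psi> k =
     (if \<exists>\<phi>. left_weyl_bv q k \<phi>
      then (let \<phi> = (SOME \<phi>. left_weyl_bv q k \<phi>)
            in - wronsk \<phi> (\<lambda>x. cnj (\<psi> x k)) / wronsk \<phi> (\<lambda>x. \<psi> x k))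
      else 0)"

definition def_set :: "(real \<Rightarrow> real) \<Rightarrow> (real \<Rightarrow> real \<Rightarrow> complex) \<Rightarrow> real set" where
  "def_set q \<psi> = {k. jost q \<psi> k \<and> (\<exists>\<phi>. left_weyl_bv q k \<phi>)}"

definition phiN :: "(real \<Rightarrow> real) \<Rightarrow> (real \<Rightarrow> real \<Rightarrow> complex) \<Rightarrow> real \<Rightarrow> real \<Rightarrow> real" where
  "phiN q \<psi> w x = 2 * Re (csqrt (refl q \<psi> w) * \<psi> x w)"

definition Gplus :: "(real \<Rightarrow> real) \<Rightarrow> (real \<Rightarrow> real \<Rightarrow> complex) \<Rightarrow> real^'n \<Rightarrow> real^'n \<Rightarrow> real \<Rightarrow> real^'n^'n" where
  "Gplus q \<psi> \<omega> \<alpha> x = (\<chi> m n. \<alpha>$m * \<alpha>$n *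
      integral {..x} (\<lambda>s. phiN q \<psi> (\<omega>$m) s * phiN q \<psi> (\<omega>$n) s))"

definition qplus :: "(real \<Rightarrow> real) \<Rightarrow> (real \<Rightarrow> real \<Rightarrow> complex) \<Rightarrow> real^'n \<Rightarrow> real^'n \<Rightarrow> real \<Rightarrow> real" where
  "qplus q \<psi> \<omega> \<alpha> x = q x - 2 * deriv (deriv (\<lambda>t. ln (det (mat 1 + Gplus q \<psi> \<omega> \<alpha> t)))) x"

end

theory Submission
  imports Defs "HOL-Real_Asymp.Real_Asymp"
begin

text \<open>Everything reduces to a solution that is square-integrable on the left. Semiboundedness forces
  the Wronskian of two square-integrable solutions to vanish at minus infinity (limit point): test
  the quadratic form on combinations of the two solutions with bumps drifting to the left. Applied
  to Weyl solutions at the energy (k + i eps)^2 and a real square-integrable solution v at the energy k^2,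
  it shows that every boundary value of the Weyl solution is a multiple of v. Hence
  R = - cnj X / X with X = W(v, psi), so that |R| = 1 and phiN is a real multiple of v.

  With a_n = alpha_n phi_n, G' = a a^T, K = (I + G)^(-1) and y = - K a, one has K' = - y y^T and
  (log det (I + G))' = - y . a; the commutator identity (l_m - l_n) G_mn = W(a_m, a_n) with
  l_n = omega_n^2 then turns y_n'' into the equation with the potential q + 2 (y . a)'. Since
  K tends to I at minus infinity, and to 0 at plus infinity (the diagonal of G grows linearly while its
  off-diagonal entries stay bounded), the integral of y y^T over the line is I.\<close>

section \<open>Integration by parts for indefinite integrals\<close>

text \<open>Since \<open>q\<close> is merely locally integrable, the derivative of a solution need
  not be differentiable at any given point. Second derivatives are therefore never taken: each
  identity about them is an identity between indefinite integrals, and \<open>indef_int\<close>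
  supplies the sum and product rules for these. A boundary value of the Weyl solution is only a
  pointwise limit, and nothing is known about the L2-norms of the approximants; the way out is that
  Im lam times the squared norm is, up to sign, a Wronskian at 0, and Wronskians at 0 do converge.
  The square root of R is the right phase because it makes r X purely imaginary, which says that v
  and Re (r psi) have vanishing Wronskian. Integrability and orthogonality of y are read off the two
  limits of K; no pointwise decay of y is established. The off-diagonal entries of G stay bounded at
  plus infinity because, up to the factor l_m - l_n, they are Wronskians of functions bounded
  together with their derivatives, whereas the diagonal entries integrate squares of functions close
  to a multiple of cos (omega_n x + t_n).\<close>

definition indef_int :: "(real \<Rightarrow> real) \<Rightarrow> (real \<Rightarrow> real) \<Rightarrow> bool" where
  "indef_int g G \<longleftrightarrow>
     (\<forall>a b. a \<le> b \<longrightarrow> g absolutely_integrable_on {a..b} \<and> (g has_integral (G b - G a)) {a..b})"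

lemma continuous_UNIV_of_subintervals:
  fixes G :: "real \<Rightarrow> 'a::topological_space"
  assumes "\<And>a b. continuous_on {a..b} G"
  shows "continuous_on UNIV G"
proof -
  have "isCont G x" for x
    by (rule continuous_on_interior[OF assms[of "x-1" "x+1"]]) simp
  then show ?thesis
    by (simp add: continuous_at_imp_continuous_on)
qed

lemma continuous_of_indefinite_integral:
  fixes G :: "real \<Rightarrow> 'a::banach"
  assumes "\<And>a b. a \<le> b \<Longrightarrow> (g has_integral (G b - G a)) {a..b}"
  shows "continuous_on UNIV G"
proof (rule continuous_UNIV_of_subintervals)
  fix a b :: real
  have "continuous_on {a..b} (\<lambda>x. G a + integral {a..x} g)"
    by (cases "a \<le> b"; force intro!: continuous_intros indefinite_integral_continuous_1
        has_integral_integrable[OF assms])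
  moreover have "G a + integral {a..x} g = G x" if "x \<in> {a..b}" for x
    using integral_unique[OF assms[of a x]] that by simp
  ultimately show "continuous_on {a..b} G"
    by (rule continuous_on_eq)
qed

lemma indef_int_continuous: "indef_int g G \<Longrightarrow> continuous_on UNIV G"
  unfolding indef_int_def by (blast intro: continuous_of_indefinite_integral)

lemma indef_int_DERIV:
  assumes "\<And>x. (F has_real_derivative F' x) (at x)" "continuous_on UNIV F'"
  shows "indef_int F' F"
  unfolding indef_int_def
proof (intro allI impI conjI)
  fix a b :: real assume "a \<le> b"
  show "F' absolutely_integrable_on {a..b}"
    using assms(2) continuous_on_subset by (blast intro: absolutely_integrable_continuous_real)
  show "(F' has_integral F b - F a) {a..b}"
    using \<open>a \<le> b\<close> assms(1)
    by (intro fundamental_theorem_of_calculus)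
       (auto simp: has_real_derivative_iff_has_vector_derivative intro: has_vector_derivative_at_within)
qed

lemma absolutely_integrable_continuous_mult:
  fixes f g :: "real \<Rightarrow> real"
  assumes "continuous_on {a..b} f" "g absolutely_integrable_on {a..b}"
  shows "(\<lambda>x. f x * g x) absolutely_integrable_on {a..b}"
  using assms by (intro absolutely_integrable_bounded_measurable_product_real)
    (auto intro: continuous_imp_measurable_on_sets_lebesgue compact_imp_bounded compact_continuous_image)

text \<open>The increment of the product splits as F s (G t - G s) + G t (F t - F s), so the defect
  is the integral of (F - F s) g - f (G t - G). Anchoring F at the left end and G at the right end
  leaves oscillations as the only factors.\<close>

lemma indef_int_mult_local:
  assumes G: "indef_int g G" and F: "indef_int f F" and "s \<le> t" "0 \<le> e"
    and oscF: "\<And>x. x \<in> {s..t} \<Longrightarrow> \<bar>F x - F s\<bar> \<le> e"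
    and oscG: "\<And>x. x \<in> {s..t} \<Longrightarrow> \<bar>G t - G x\<bar> \<le> e"
  shows "\<bar>integral {s..t} (\<lambda>x. f x * G x + F x * g x) - (F t * G t - F s * G s)\<bar>
    \<le> e * integral {s..t} (\<lambda>x. \<bar>f x\<bar> + \<bar>g x\<bar>)"
proof -
  have cG: "continuous_on {s..t} G" and cF: "continuous_on {s..t} F"
    using indef_int_continuous F G continuous_on_subset by blast+
  have ag: "g absolutely_integrable_on {s..t}" and af: "f absolutely_integrable_on {s..t}"
    and ig: "(g has_integral (G t - G s)) {s..t}" and jf: "(f has_integral (F t - F s)) {s..t}"
    using F G \<open>s \<le> t\<close> unfolding indef_int_def by auto
  have i1: "(\<lambda>x. G x * f x) absolutely_integrable_on {s..t}"
    and i2: "(\<lambda>x. F x * g x) absolutely_integrable_on {s..t}"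
    using absolutely_integrable_continuous_mult cG cF ag af by blast+
  have fGFg: "(\<lambda>x. f x * G x + F x * g x) integrable_on {s..t}"
    using set_integral_add(1)[OF i1 i2] set_lebesgue_integral_eq_integral(1)
    by (simp add: mult.commute)
  let ?h = "\<lambda>x. (F x - F s) * g x - f x * (G t - G x)"
  have "((\<lambda>x. (f x * G x + F x * g x) - F s * g x - G t * f x) has_integral
      integral {s..t} (\<lambda>x. f x * G x + F x * g x) - F s * (G t - G s) - G t * (F t - F s)) {s..t}"
    by (intro has_integral_diff has_integral_mult_right integrable_integral fGFg ig jf)
  then have "(?h has_integral
      integral {s..t} (\<lambda>x. f x * G x + F x * g x) - (F t * G t - F s * G s)) {s..t}"
    by (simp add: algebra_simps)
  then have h: "?h integrable_on {s..t}"
    "integral {s..t} ?h = integral {s..t} (\<lambda>x. f x * G x + F x * g x) - (F t * G t - F s * G s)"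
    by (auto simp: integral_unique has_integral_integrable)
  have "\<bar>integral {s..t} ?h\<bar> \<le> integral {s..t} (\<lambda>x. e * (\<bar>f x\<bar> + \<bar>g x\<bar>))"
  proof (rule integral_norm_bound_integral[OF h(1), unfolded real_norm_def])
    show "(\<lambda>x. e * (\<bar>f x\<bar> + \<bar>g x\<bar>)) integrable_on {s..t}"
      using ag af by (auto intro!: integrable_on_mult_right integrable_add simp: absolutely_integrable_on_def)
    fix x assume x: "x \<in> {s..t}"
    have "\<bar>?h x\<bar> \<le> \<bar>F x - F s\<bar> * \<bar>g x\<bar> + \<bar>f x\<bar> * \<bar>G t - G x\<bar>"
      by (metis abs_mult abs_triangle_ineq4)
    also have "\<dots> \<le> e * \<bar>g x\<bar> + \<bar>f x\<bar> * e"
      using oscF[OF x] oscG[OF x] by (intro add_mono mult_mono) auto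
    finally show "\<bar>?h x\<bar> \<le> e * (\<bar>f x\<bar> + \<bar>g x\<bar>)"
      by (simp add: algebra_simps)
  qed
  then show ?thesis
    by (simp add: h(2))
qed

text \<open>The product rule when one factor is only absolutely continuous: the defect of the formula on an
  interval is additive, and locally at most e times the integral of |f| + |g|, for every e.\<close>
lemma indef_int_mult:
  assumes G: "indef_int g G" and F: "indef_int f F"
  shows "indef_int (\<lambda>x. f x * G x + F x * g x) (\<lambda>x. F x * G x)"
  unfolding indef_int_def
proof (intro allI impI)
  fix a b :: real assume ab: "a \<le> b"
  let ?h = "\<lambda>x. f x * G x + F x * g x" and ?m = "\<lambda>x. \<bar>f x\<bar> + \<bar>g x\<bar>"
  have cG: "continuous_on UNIV G" and cF: "continuous_on UNIV F"
    using indef_int_continuous F G by blast+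
  have ag: "g absolutely_integrable_on {s..t}" and af: "f absolutely_integrable_on {s..t}" for s t
    by (cases "s \<le> t"; use F G in \<open>auto simp: indef_int_def\<close>)+
  have ah: "?h absolutely_integrable_on {s..t}" for s t
  proof -
    have "(\<lambda>x. G x * f x) absolutely_integrable_on {s..t}" "(\<lambda>x. F x * g x) absolutely_integrable_on {s..t}"
      by (intro absolutely_integrable_continuous_mult ag af continuous_on_subset[OF cG] continuous_on_subset[OF cF]; simp)+
    then show ?thesis
      using set_integral_add(1) by (fastforce simp: mult.commute)
  qed
  then have ih: "?h integrable_on {s..t}" for s t
    using set_lebesgue_integral_eq_integral(1) by blast
  have im: "?m integrable_on {s..t}" for s t
    using ag af by (auto intro!: integrable_add simp: absolutely_integrable_on_def)
  define D where "D s t = integral {s..t} ?h - (F t * G t - F s * G s)" for s t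
  have D_le: "\<bar>D a b\<bar> \<le> e * integral {a..b} ?m" if "e > 0" for e
    using ab
  proof (induction a b rule: Bolzano)
    case (trans a b c)
    have "D a c = D a b + D b c"
      unfolding D_def using Henstock_Kurzweil_Integration.integral_combine[OF trans(3,4) ih] by simp
    moreover have "integral {a..c} ?m = integral {a..b} ?m + integral {b..c} ?m"
      using Henstock_Kurzweil_Integration.integral_combine[OF trans(3,4) im] by simp
    ultimately show ?case
      using trans(1,2) by (simp add: algebra_simps)
  next
    case (local x)
    from cF obtain d1 where d1: "d1 > 0" "\<And>y. \<bar>y - x\<bar> < d1 \<Longrightarrow> \<bar>F y - F x\<bar> < e/2"
      unfolding continuous_on_iff dist_real_def using \<open>e > 0\<close> by (metis UNIV_I half_gt_zero)
    from cG obtain d2 where d2: "d2 > 0" "\<And>y. \<bar>y - x\<bar> < d2 \<Longrightarrow> \<bar>G y - G x\<bar> < e/2"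
      unfolding continuous_on_iff dist_real_def using \<open>e > 0\<close> by (metis UNIV_I half_gt_zero)
    show ?case
    proof (rule exI[of _ "min d1 d2"], intro conjI allI impI)
      fix s t assume st: "s \<le> x \<and> x \<le> t \<and> t - s < min d1 d2"
      have "\<bar>F y - F s\<bar> \<le> e" "\<bar>G t - G y\<bar> \<le> e" if "y \<in> {s..t}" for y
      proof -
        have "\<bar>y - x\<bar> < min d1 d2" "\<bar>s - x\<bar> < min d1 d2" "\<bar>t - x\<bar> < min d1 d2"
          using that st by (auto simp: abs_if)
        then have "\<bar>F y - F x\<bar> < e/2" "\<bar>F s - F x\<bar> < e/2" "\<bar>G y - G x\<bar> < e/2" "\<bar>G t - G x\<bar> < e/2"
          by (intro d1(2) d2(2); simp)+
        then show "\<bar>F y - F s\<bar> \<le> e" "\<bar>G t - G y\<bar> \<le> e"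
          by linarith+
      qed
      with indef_int_mult_local[OF G F, of s t e] show "\<bar>D s t\<bar> \<le> e * integral {s..t} ?m"
        using st \<open>e > 0\<close> unfolding D_def by auto
    qed (use d1 d2 in auto)
  qed
  have "\<bar>D a b\<bar> \<le> 0"
  proof (rule field_le_epsilon)
    fix e :: real assume "e > 0"
    define M where "M = integral {a..b} ?m"
    have "M \<ge> 0" unfolding M_def by (intro integral_nonneg im) auto
    \<comment> \<open>The shift by 1 keeps the quotient meaningful when M = 0.\<close>
    have "\<bar>D a b\<bar> \<le> e / (M + 1) * M"
      using D_le[of "e / (M+1)"] \<open>e > 0\<close> \<open>M \<ge> 0\<close> unfolding M_def by auto
    also have "\<dots> \<le> e"
      using \<open>e > 0\<close> \<open>M \<ge> 0\<close> by (simp add: field_simps)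
    finally show "\<bar>D a b\<bar> \<le> 0 + e" by simp
  qed
  then show "?h absolutely_integrable_on {a..b} \<and> (?h has_integral F b * G b - F a * G a) {a..b}"
    using ah integrable_integral[OF ih[of a b]] unfolding D_def by simp
qed

lemma indef_int_add:
  assumes "indef_int f F" "indef_int g G"
  shows "indef_int (\<lambda>x. f x + g x) (\<lambda>x. F x + G x)"
  unfolding indef_int_def
proof (intro allI impI conjI)
  fix a b :: real assume "a \<le> b"
  show "(\<lambda>x. f x + g x) absolutely_integrable_on {a..b}"
    using assms \<open>a \<le> b\<close> by (auto intro: set_integral_add(1) simp: indef_int_def)
  show "((\<lambda>x. f x + g x) has_integral F b + G b - (F a + G a)) {a..b}"
    using has_integral_add[of f "F b - F a" "{a..b}" g "G b - G a"] assms \<open>a \<le> b\<close>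
    by (simp add: indef_int_def algebra_simps)
qed

lemma indef_int_cmult:
  assumes "indef_int f F"
  shows "indef_int (\<lambda>x. c * f x) (\<lambda>x. c * F x)"
  unfolding indef_int_def
proof (intro allI impI conjI)
  fix a b :: real assume "a \<le> b"
  with assms have f: "f absolutely_integrable_on {a..b}" "(f has_integral (F b - F a)) {a..b}"
    by (auto simp: indef_int_def)
  show "(\<lambda>x. c * f x) absolutely_integrable_on {a..b}"
    using f(1) by (rule set_integrable_mult_right)
  show "((\<lambda>x. c * f x) has_integral c * F b - c * F a) {a..b}"
    using has_integral_mult_right[OF f(2), of c] by (simp add: right_diff_distrib)
qed

lemma indef_int_diff:
  assumes "indef_int f F" "indef_int g G"
  shows "indef_int (\<lambda>x. f x - g x) (\<lambda>x. F x - G x)"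
  using indef_int_add[OF assms(1) indef_int_cmult[OF assms(2), of "-1"]] by simp

lemma indef_int_const: "indef_int (\<lambda>_. 0) (\<lambda>_. c)"
  by (simp add: indef_int_def)

lemma indef_int_sum:
  assumes "finite I" "\<And>i. i \<in> I \<Longrightarrow> indef_int (f i) (F i)"
  shows "indef_int (\<lambda>x. \<Sum>i\<in>I. f i x) (\<lambda>x. \<Sum>i\<in>I. F i x)"
  using assms by (induction I) (simp_all add: indef_int_add indef_int_const)

section \<open>Square-integrability near minus infinity and the energy form\<close>

lemma L2_left_continuousI:
  fixes f :: "real \<Rightarrow> real"
  assumes "continuous_on UNIV f" "L2_left g" "\<And>x. \<bar>f x\<bar> \<le> norm (g x)"
  shows "L2_left f"
  unfolding L2_left_def
proof (intro conjI allI)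
  show m: "f \<in> borel_measurable lborel"
    using borel_measurable_continuous_onI[OF assms(1)] by simp
  fix a :: real
  have "set_integrable lborel {..a} (\<lambda>x. (norm (g x))\<^sup>2)"
    using assms(2) by (simp add: L2_left_def)
  then show "set_integrable lborel {..a} (\<lambda>x. (norm (f x))\<^sup>2)"
    unfolding set_integrable_def
  proof (rule Bochner_Integration.integrable_bound)
    show "(\<lambda>x. indicat_real {..a} x *\<^sub>R (norm (f x))\<^sup>2) \<in> borel_measurable lborel"
      using m by measurable
    show "AE x in lborel. norm (indicat_real {..a} x *\<^sub>R (norm (f x))\<^sup>2)
        \<le> norm (indicat_real {..a} x *\<^sub>R (norm (g x))\<^sup>2)"
      using power_mono[OF assms(3), of _ 2] by (auto simp: indicator_def)
  qed
qed

lemma L2_left_mult_set_integrable: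
  fixes f g :: "real \<Rightarrow> real"
  assumes "L2_left f" "L2_left g"
  shows "set_integrable lborel {..a} (\<lambda>x. f x * g x)"
proof -
  have "set_integrable lborel {..a} (\<lambda>x. (norm (f x))\<^sup>2 + (norm (g x))\<^sup>2)"
    using assms by (auto intro: set_integral_add(1) simp: L2_left_def)
  then show ?thesis
    unfolding set_integrable_def
  proof (rule Bochner_Integration.integrable_bound)
    have "f \<in> borel_measurable lborel" "g \<in> borel_measurable lborel"
      using assms by (auto simp: L2_left_def)
    then show "(\<lambda>x. indicat_real {..a} x *\<^sub>R (f x * g x)) \<in> borel_measurable lborel"
      by measurable
    have "\<bar>x * y\<bar> \<le> x\<^sup>2 + y\<^sup>2" for x y :: real
      using sum_squares_bound[of "\<bar>x\<bar>" "\<bar>y\<bar>"] mult_nonneg_nonneg[of "\<bar>x\<bar>" "\<bar>y\<bar>"]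
      unfolding abs_mult power2_abs by linarith
    then show "AE x in lborel. norm (indicat_real {..a} x *\<^sub>R (f x * g x))
        \<le> norm (indicat_real {..a} x *\<^sub>R ((norm (f x))\<^sup>2 + (norm (g x))\<^sup>2))"
      by (auto simp: indicator_def intro!: AE_I2)
  qed
qed

lemma L2_left_add:
  fixes f g :: "real \<Rightarrow> real"
  assumes "L2_left f" "L2_left g"
  shows "L2_left (\<lambda>x. f x + g x)"
proof -
  have "set_integrable lborel {..a} (\<lambda>x. f x * f x + (f x * g x + (f x * g x + g x * g x)))" for a
    using assms by (intro set_integral_add(1) L2_left_mult_set_integrable)
  moreover have "(\<lambda>x. (norm (f x + g x))\<^sup>2) = (\<lambda>x. f x * f x + (f x * g x + (f x * g x + g x * g x)))"
    by (auto simp: power2_eq_square algebra_simps)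
  ultimately show ?thesis
    using assms by (auto simp: L2_left_def)
qed

lemma L2_left_cmult:
  fixes f :: "real \<Rightarrow> real"
  assumes "L2_left f"
  shows "L2_left (\<lambda>x. c * f x)"
  using assms by (auto simp: L2_left_def power_mult_distrib abs_mult)

text \<open>Passes from Lebesgue integrability on left half-lines to the gauge integral. The
  vanishing tail fixes the value at minus infinity of the Wronskians and of the entries of
  G.\<close>

lemma integral_left_tail:
  fixes f :: "real \<Rightarrow> real"
  assumes "\<And>a. set_integrable lborel {..a} f"
  shows "f integrable_on {..a}"
    and "a \<le> b \<Longrightarrow> f integrable_on {a..b}"
    and "a \<le> b \<Longrightarrow> integral {..b} f = integral {..a} f + integral {a..b} f"
    and "((\<lambda>x. integral {..x} f) \<longlongrightarrow> 0) at_bot"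
proof -
  show left: "f integrable_on {..a}" for a
    using assms set_borel_integral_eq_integral(1) by blast
  have ab: "set_integrable lborel {a..b} f" for a b
    by (rule set_integrable_subset[OF assms[of b]]) auto
  show abi: "f integrable_on {a..b}" for a b
    using ab set_borel_integral_eq_integral(1) by blast
  show split: "integral {..b} f = integral {..a} f + integral {a..b} f" if "a \<le> b" for a b
  proof -
    have "{..b} = {..a} \<union> {a..b}" "{..a} \<inter> {a..b} = {a}" using that by auto
    then show ?thesis
      using integral_Un[OF left[of a] abi[of a b]] by simp
  qed
  have "((\<lambda>a. LINT x:{a..0}|lborel. f x) \<longlongrightarrow> (LINT x:{..0}|lborel. f x)) at_bot"
    by (rule tendsto_set_lebesgue_integral_at_bot) (auto intro: assms)
  then have "((\<lambda>a. integral {a..0} f) \<longlongrightarrow> integral {..0} f) at_bot"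
    using set_borel_integral_eq_integral(2)[OF ab] set_borel_integral_eq_integral(2)[OF assms] by simp
  then have "((\<lambda>a. integral {..0} f - integral {a..0} f) \<longlongrightarrow> integral {..0} f - integral {..0} f) at_bot"
    by (intro tendsto_intros)
  moreover have "\<forall>\<^sub>F a in at_bot. integral {..0} f - integral {a..0} f = integral {..a} f"
    using eventually_le_at_bot[of 0] by eventually_elim (simp add: split)
  ultimately show "((\<lambda>x. integral {..x} f) \<longlongrightarrow> 0) at_bot"
    using tendsto_cong by fastforce
qed

text \<open>The equation f'' = q f - h. The inhomogeneity h is kept general because the real and imaginary parts
  of a solution at a complex energy satisfy a coupled system.\<close>
definition rsol ::
  "(real \<Rightarrow> real) \<Rightarrow> (real \<Rightarrow> real) \<Rightarrow> (real \<Rightarrow> real) \<Rightarrow> (real \<Rightarrow> real) \<Rightarrow> bool" where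
  "rsol q h f f' \<longleftrightarrow> (\<forall>x. (f has_real_derivative f' x) (at x)) \<and> indef_int (\<lambda>s. q s * f s - h s) f'"

lemma rsol_indef_int: "rsol q h f f' \<Longrightarrow> indef_int f' f"
  unfolding rsol_def by (blast intro: indef_int_DERIV indef_int_continuous)

lemma rsol_continuous:
  assumes "rsol q h f f'"
  shows "continuous_on UNIV f" "continuous_on UNIV f'"
  using rsol_indef_int[OF assms] assms unfolding rsol_def by (blast intro: indef_int_continuous)+

text \<open>The \<open>q\<close>-terms cancel: f (q g - k) - (q f - h) g = h g - f k.\<close>

lemma wronskian_indef_int:
  assumes "rsol q h f f'" "rsol q k g g'"
  shows "indef_int (\<lambda>x. h x * g x - f x * k x) (\<lambda>x. f x * g' x - f' x * g x)"
proof -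
  have "indef_int (\<lambda>x. q x * g x - k x) g'" "indef_int (\<lambda>x. q x * f x - h x) f'"
    using assms by (auto simp: rsol_def)
  from indef_int_diff[OF indef_int_mult[OF this(1) rsol_indef_int[OF assms(1)]]
      indef_int_mult[OF rsol_indef_int[OF assms(2)] this(2)]]
  show ?thesis
    by (simp add: algebra_simps)
qed

text \<open>With r = z f' + y g', the integrand u'^2 + q u^2 of the quadratic form differs from the integrand on
  the right-hand side by (u r)', which integrates to zero.\<close>
lemma energy_inequality:
  fixes q :: "real \<Rightarrow> real"
  assumes sb: "\<And>(u::real \<Rightarrow> real) a b. u C1_differentiable_on UNIV \<Longrightarrow>
          (\<And>x. x \<notin> {a<..<b} \<Longrightarrow> u x = 0) \<Longrightarrow>
          C * integral {a..b} (\<lambda>x. (u x)\<^sup>2)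
            \<le> integral {a..b} (\<lambda>x. (vector_derivative u (at x))\<^sup>2 + q x * (u x)\<^sup>2)"
    and f: "rsol q h f f'" and g: "rsol q k g g'"
    and h: "continuous_on UNIV h" and k: "continuous_on UNIV k"
    and z: "\<And>x. (z has_real_derivative z' x) (at x)" "continuous_on UNIV z'"
    and y: "\<And>x. (y has_real_derivative y' x) (at x)" "continuous_on UNIV y'"
    and supp: "\<And>x. x \<notin> {a<..<b} \<Longrightarrow> z x = 0" "\<And>x. x \<notin> {a<..<b} \<Longrightarrow> y x = 0"
    and "a \<le> b"
  defines "u \<equiv> \<lambda>x. z x * f x + y x * g x"
  shows "C * integral {a..b} (\<lambda>x. (u x)\<^sup>2) \<le> integral {a..b} (\<lambda>x. (z' x * f x + y' x * g x)\<^sup>2 +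
     (z' x * y x - z x * y' x) * (f x * g' x - f' x * g x) + u x * (z x * h x + y x * k x))"
proof -
  let ?R = "\<lambda>x. (z' x * f x + y' x * g x)\<^sup>2 +
     (z' x * y x - z x * y' x) * (f x * g' x - f' x * g x) + u x * (z x * h x + y x * k x)"
  define u' where "u' x = (z' x * f x + z x * f' x) + (y' x * g x + y x * g' x)" for x
  define r where "r x = z x * f' x + y x * g' x" for x
  define r' where "r' x = (z' x * f' x + z x * (q x * f x - h x)) + (y' x * g' x + y x * (q x * g x - k x))" for x
  note zy = indef_int_DERIV[OF z] indef_int_DERIV[OF y]
  have fg: "indef_int (\<lambda>x. q x * f x - h x) f'" "indef_int (\<lambda>x. q x * g x - k x) g'"
    using f g by (auto simp: rsol_def)
  have iu: "indef_int u' u"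
    unfolding u_def u'_def
    by (intro indef_int_add indef_int_mult zy rsol_indef_int[OF f] rsol_indef_int[OF g])
  have ir: "indef_int r' r"
    unfolding r_def r'_def by (intro indef_int_add indef_int_mult zy fg)
  note cont = rsol_continuous[OF f] rsol_continuous[OF g] h k z(2) y(2)
    indef_int_continuous[OF zy(1)] indef_int_continuous[OF zy(2)]
  have cu: "continuous_on UNIV u" and cu': "continuous_on UNIV u'"
    unfolding u_def u'_def by (intro continuous_intros cont)+
  have du: "(u has_real_derivative u' x) (at x)" for x
    using f g unfolding u_def u'_def rsol_def
    by (auto intro!: derivative_eq_intros z(1) y(1))
  then have vdu: "vector_derivative u (at x) = u' x" for x
    by (simp add: has_real_derivative_iff_has_vector_derivative vector_derivative_at)
  have C1: "u C1_differentiable_on UNIV"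
    unfolding C1_differentiable_on_def
    using du cu' by (auto simp: has_real_derivative_iff_has_vector_derivative)
  have u0: "u x = 0" if "x \<notin> {a<..<b}" for x
    using supp that by (simp add: u_def)
  have "((\<lambda>x. u' x * r x + u x * r' x) has_integral u b * r b - u a * r a) {a..b}"
    using indef_int_mult[OF ir iu] \<open>a \<le> b\<close> by (simp add: indef_int_def)
  then have "((\<lambda>x. u' x * r x + u x * r' x) has_integral 0) {a..b}"
    using u0[of a] u0[of b] by simp
  moreover have "continuous_on UNIV ?R"
    by (intro continuous_intros cont cu)
  then have "?R integrable_on {a..b}"
    using continuous_on_subset by (blast intro: integrable_continuous_real)
  then have "(?R has_integral integral {a..b} ?R) {a..b}"
    by (rule integrable_integral)
  ultimately have "((\<lambda>x. (u' x * r x + u x * r' x) + ?R x) has_integral (0 + integral {a..b} ?R)) {a..b}"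
    by (rule has_integral_add)
  moreover have "(u' x * r x + u x * r' x) + ?R x = (vector_derivative u (at x))\<^sup>2 + q x * (u x)\<^sup>2" for x
    unfolding vdu unfolding u'_def r_def r'_def u_def by (simp add: power2_eq_square algebra_simps)
  ultimately have "integral {a..b} (\<lambda>x. (vector_derivative u (at x))\<^sup>2 + q x * (u x)\<^sup>2) = integral {a..b} ?R"
    by (simp add: integral_unique)
  moreover have "C * integral {a..b} (\<lambda>x. (u x)\<^sup>2)
      \<le> integral {a..b} (\<lambda>x. (vector_derivative u (at x))\<^sup>2 + q x * (u x)\<^sup>2)"
    by (rule sb[OF C1]) (rule u0)
  ultimately show ?thesis
    by simp
qed

section \<open>The limit-point property\<close>

lemma DERIV_max_0_power2:
  "((\<lambda>x::real. (max 0 x)\<^sup>2) has_real_derivative 2 * max 0 x) (at x)"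
proof -
  consider "x > 0" | "x < 0" | "x = 0" by linarith
  then show ?thesis
  proof cases
    case 1
    have "((\<lambda>x::real. x\<^sup>2) has_real_derivative 2 * x) (at x)"
      by (auto intro!: derivative_eq_intros)
    then have "((\<lambda>x::real. (max 0 x)\<^sup>2) has_real_derivative 2 * x) (at x)"
      by (rule has_field_derivative_transform_within_open[where S="{0<..}"]) (use 1 in auto)
    then show ?thesis using 1 by simp
  next
    case 2
    have "((\<lambda>x::real. 0) has_real_derivative 0) (at x)"
      by simp
    then have "((\<lambda>x::real. (max 0 x)\<^sup>2) has_real_derivative 0) (at x)"
      by (rule has_field_derivative_transform_within_open[where S="{..<0}"]) (use 2 in auto)
    then show ?thesis using 2 by simp
  next
    case 3
    have "((\<lambda>h::real. (max 0 h)\<^sup>2 / h) \<longlongrightarrow> 0) (at 0)"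
    proof (rule tendsto_sandwich[of "\<lambda>h. - \<bar>h\<bar>" _ _ "\<lambda>h. \<bar>h\<bar>"])
      show "\<forall>\<^sub>F h::real in at 0. - \<bar>h\<bar> \<le> (max 0 h)\<^sup>2 / h" "\<forall>\<^sub>F h::real in at 0. (max 0 h)\<^sup>2 / h \<le> \<bar>h\<bar>"
        by (auto simp: max_def power2_eq_square)
    qed (auto intro!: tendsto_eq_intros)
    then show ?thesis
      using 3 by (simp add: has_field_derivative_iff)
  qed
qed

text \<open>Squares of truncations are C1 across the corner, which is the regularity asked of test
  functions in \<open>semibounded\<close>; on the unit interval a polynomial is left, so that the
  square integrates in closed form.\<close>

definition bump :: "real \<Rightarrow> real" where
  "bump x = (max 0 x)\<^sup>2 * (max 0 (1 - x))\<^sup>2"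

definition bump' :: "real \<Rightarrow> real" where
  "bump' x = 2 * max 0 x * (max 0 (1 - x))\<^sup>2 - (max 0 x)\<^sup>2 * (2 * max 0 (1 - x))"

lemma DERIV_bump: "(bump has_real_derivative bump' x) (at x)"
proof -
  have "((\<lambda>x::real. (max 0 (1 - x))\<^sup>2) has_real_derivative 2 * max 0 (1 - x) * (0 - 1)) (at x)"
    by (rule DERIV_chain'[OF _ DERIV_max_0_power2]) (auto intro!: derivative_eq_intros)
  from DERIV_mult[OF DERIV_max_0_power2 this] show ?thesis
    unfolding bump_def[abs_def] bump'_def by (simp add: algebra_simps)
qed

lemma bump_outside: "x \<notin> {0<..<1} \<Longrightarrow> bump x = 0"
  by (auto simp: bump_def)

lemma bump_inside: "x \<in> {0..1} \<Longrightarrow> bump x = (x * (1 - x))\<^sup>2"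
  by (auto simp: bump_def power_mult_distrib)

lemma continuous_bump: "continuous_on S bump" "continuous_on S bump'"
  unfolding bump_def[abs_def] bump'_def[abs_def] by (intro continuous_intros)+

lemma bump_bounds:
  assumes "x \<in> {0..1}"
  shows "0 \<le> bump x" "bump x \<le> 1" "\<bar>bump' x\<bar> \<le> 2"
proof -
  define p where "p = x * (1 - x)"
  have p: "0 \<le> p" "p \<le> 1" using assms by (auto simp: p_def intro: mult_le_one)
  show "0 \<le> bump x" "bump x \<le> 1"
    using p bump_inside[OF assms] by (auto simp: p_def[symmetric] power_le_one)
  have "bump' x = 2 * (p * (1 - 2 * x))"
    using assms by (auto simp: bump'_def p_def power2_eq_square algebra_simps)
  moreover have "\<bar>p * (1 - 2 * x)\<bar> \<le> 1"
    using p assms unfolding abs_mult by (intro mult_le_one) auto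
  ultimately show "\<bar>bump' x\<bar> \<le> 2" by simp
qed

text \<open>The value is the Beta integral of y^4 (1 - y)^4 over the unit interval, 4! 4! / 9! =
  1/630; \<open>?Q\<close> in the proof is the expanded antiderivative.\<close>

lemma bump_integral: "((\<lambda>x. (bump (x + t))\<^sup>2) has_integral 1/630) {-t..1-t}"
proof -
  let ?Q = "\<lambda>y::real. y^5/5 - 4*y^6/6 + 6*y^7/7 - 4*y^8/8 + y^9/9"
  have "((\<lambda>x. (((x + t) * (1 - (x + t)))\<^sup>2)\<^sup>2) has_integral ?Q ((1 - t) + t) - ?Q (- t + t)) {-t..1-t}"
  proof (rule fundamental_theorem_of_calculus)
    fix x
    have "((\<lambda>x. ?Q (x + t)) has_real_derivative (((x + t) * (1 - (x + t)))\<^sup>2)\<^sup>2) (at x)"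
      by (auto intro!: derivative_eq_intros simp del: add_diff_eq)
         (simp add: field_simps eval_nat_numeral)
    then show "((\<lambda>x. ?Q (x + t)) has_vector_derivative (((x + t) * (1 - (x + t)))\<^sup>2)\<^sup>2) (at x within {-t..1-t})"
      using has_vector_derivative_at_within
      by (auto simp: has_real_derivative_iff_has_vector_derivative)
  qed simp
  then have "((\<lambda>x. (((x + t) * (1 - (x + t)))\<^sup>2)\<^sup>2) has_integral 1/630) {-t..1-t}"
    by simp
  then show ?thesis
    by (rule has_integral_eq[rotated]) (simp add: bump_inside)
qed

text \<open>The bumps z(x) = bump(x + n) and y(x) = (x + n) bump(x + n) satisfy z y' - z' y = bump(x + n)^2, so that
  a nonzero limit w of the Wronskian would contribute |w|/630 to the energy for every n.\<close>
theorem wronskian_left: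
  assumes sb: "semibounded q"
    and f: "rsol q h f f'" and g: "rsol q k g g'"
    and h: "continuous_on UNIV h" and k: "continuous_on UNIV k"
    and L2: "L2_left f" "L2_left g" "L2_left h" "L2_left k"
  shows "f x * g' x - f' x * g x = integral {..x} (\<lambda>s. h s * g s - f s * k s)"
proof -
  obtain C where C: "\<And>(u::real \<Rightarrow> real) a b. u C1_differentiable_on UNIV \<Longrightarrow>
          (\<And>x. x \<notin> {a<..<b} \<Longrightarrow> u x = 0) \<Longrightarrow>
          C * integral {a..b} (\<lambda>x. (u x)\<^sup>2)
            \<le> integral {a..b} (\<lambda>x. (vector_derivative u (at x))\<^sup>2 + q x * (u x)\<^sup>2)"
    using sb unfolding semibounded_def by blast
  let ?w = "\<lambda>s. h s * g s - f s * k s"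
  define W where "W x = f x * g' x - f' x * g x" for x
  define J where "J x = integral {..x} ?w" for x
  \<comment> \<open>W and J have the same increments and J vanishes at minus infinity, so w is the
    limit of W there.\<close>
  define w where "w = W 0 - J 0"
  note cont = rsol_continuous[OF f] rsol_continuous[OF g] h k
  have wi: "set_integrable lborel {..a} ?w" for a
    using L2 by (intro set_integral_diff(1) L2_left_mult_set_integrable)
  have "W b - W a = J b - J a" if "a \<le> b" for a b
  proof -
    have "(?w has_integral W b - W a) {a..b}"
      using wronskian_indef_int[OF f g] that unfolding W_def indef_int_def by blast
    then show ?thesis
      using integral_left_tail(3)[of ?w a b, OF wi that] unfolding J_def by (simp add: integral_unique)
  qed
  from this[of 0] this[of _ 0] have WJ: "W x = w + J x" for x
    unfolding w_def by (cases "x \<le> 0") (force simp: algebra_simps)+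
  have J0: "(J \<longlongrightarrow> 0) at_bot"
    using integral_left_tail(4)[of ?w, OF wi] unfolding J_def .
  \<comment> \<open>D dominates every quadratic error term of the energy inequality. Its mass
    \<open>T n\<close> in the unit window [-n, 1-n] tends to 0 because D is integrable on the
    left.\<close>
  define D where "D s = f s * f s + g s * g s + h s * h s + k s * k s" for s
  have Di: "set_integrable lborel {..a} D" for a
    using L2 unfolding D_def by (intro set_integral_add(1) L2_left_mult_set_integrable)
  define T where "T n = integral {-n..1-n} D" for n :: real
  have "(T \<longlongrightarrow> 0 - 0) at_top"
  proof -
    let ?L = "\<lambda>x. integral {..x} D"
    have lim: "(?L \<longlongrightarrow> 0) at_bot"
      using integral_left_tail(4)[of D, OF Di] .
    have "filterlim (\<lambda>n::real. 1 - n) at_bot at_top"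
      unfolding filterlim_at_bot
    proof
      fix Z :: real
      show "\<forall>\<^sub>F n in at_top. 1 - n \<le> Z"
        using eventually_ge_at_top[of "1 - Z"] by eventually_elim simp
    qed
    from filterlim_compose[OF lim this] filterlim_compose[OF lim filterlim_uminus_at_bot_at_top]
    have "((\<lambda>n. ?L (1 - n) - ?L (-n)) \<longlongrightarrow> 0 - 0) at_top"
      by (rule tendsto_diff)
    moreover have "?L (1 - n) - ?L (-n) = T n" for n
      using integral_left_tail(3)[of D "-n" "1-n", OF Di] by (simp add: T_def)
    ultimately show ?thesis by simp
  qed
  then have T0: "(T \<longlongrightarrow> 0) at_top" by simp
  \<comment> \<open>18 comes from the square of z' f + y' g with both coefficients at most 3, 1 from
    the AM-GM bound for the inhomogeneous term, and 2 |C| from C u^2, where u^2 is at most twice f^2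
    + g^2.\<close>
  define M where "M = 19 + 2 * \<bar>C\<bar>"
  \<comment> \<open>The sign \<open>\<sigma>\<close> is built into y, so that the Wronskian term can
    be tested with either sign and a nonzero limit of either sign is refuted by the same
    inequality.\<close>
  have key: "integral {-n..1-n} (\<lambda>x. (bump (x+n))\<^sup>2 * (\<sigma> * W x)) \<le> M * T n" if \<sigma>: "\<bar>\<sigma>\<bar> = 1" for \<sigma> n :: real
  proof -
    define z where "z x = bump (x + n)" for x
    define z' where "z' x = bump' (x + n)" for x
    define y where "y x = \<sigma> * (x + n) * bump (x + n)" for x
    define y' where "y' x = \<sigma> * (bump (x + n) + (x + n) * bump' (x + n))" for x
    define u where "u x = z x * f x + y x * g x" for x
    have dz: "(z has_real_derivative z' x) (at x)" for x
    proof -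
      have "((\<lambda>x. x + n) has_real_derivative 1) (at x)"
        by (auto intro!: derivative_eq_intros)
      from DERIV_chain'[OF this DERIV_bump] show ?thesis
        unfolding z_def[abs_def] z'_def by simp
    qed
    have dy: "(y has_real_derivative y' x) (at x)" for x
      using dz[of x] unfolding z_def[abs_def] z'_def y_def[abs_def] y'_def
      by (auto intro!: derivative_eq_intros simp: algebra_simps)
    have cz: "continuous_on UNIV z" "continuous_on UNIV z'" "continuous_on UNIV y" "continuous_on UNIV y'"
      unfolding z_def z'_def y_def y'_def
      by (intro continuous_intros continuous_on_compose2[OF continuous_bump(1)[of UNIV]]
          continuous_on_compose2[OF continuous_bump(2)[of UNIV]]; simp)+
    have cu: "continuous_on UNIV u"
      unfolding u_def by (intro continuous_intros cz cont)
    have supp: "z x = 0" "y x = 0" if "x \<notin> {-n<..<1-n}" for x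
      using that bump_outside[of "x + n"] by (auto simp: z_def y_def)
    let ?R = "\<lambda>x. (z' x * f x + y' x * g x)\<^sup>2 + (z' x * y x - z x * y' x) * (f x * g' x - f' x * g x)
        + u x * (z x * h x + y x * k x)"
    have E: "C * integral {-n..1-n} (\<lambda>x. (u x)\<^sup>2) \<le> integral {-n..1-n} ?R"
      unfolding u_def
      by (rule energy_inequality[OF _ f g h k dz cz(2) dy cz(4) supp]) (use C in auto)
    let ?S = "\<lambda>x. (z' x * f x + y' x * g x)\<^sup>2 + u x * (z x * h x + y x * k x) - C * (u x)\<^sup>2"
    have int: "p integrable_on {-n..1-n}" if "continuous_on UNIV p" for p :: "real \<Rightarrow> real"
      using that by (blast intro: integrable_continuous_real continuous_on_subset)
    have cW: "continuous_on UNIV W"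
      unfolding W_def by (intro continuous_intros cont)
    have RS: "?R x = (?S x + C * (u x)\<^sup>2) - (bump (x+n))\<^sup>2 * (\<sigma> * W x)" for x
      by (simp add: W_def z_def z'_def y_def y'_def power2_eq_square algebra_simps)
    have cb: "continuous_on UNIV (\<lambda>x. (bump (x+n))\<^sup>2 * (\<sigma> * W x))"
      using cz(1) unfolding z_def by (intro continuous_intros cW)
    have iS: "?S integrable_on {-n..1-n}"
      by (intro int continuous_intros cz cu cont)
    have "integral {-n..1-n} ?R = (integral {-n..1-n} ?S + C * integral {-n..1-n} (\<lambda>x. (u x)\<^sup>2))
        - integral {-n..1-n} (\<lambda>x. (bump (x+n))\<^sup>2 * (\<sigma> * W x))"
      unfolding RS
      apply (subst integral_diff)
        apply (intro int continuous_intros cz cu cont)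
       apply (rule int[OF cb])
      apply (subst Henstock_Kurzweil_Integration.integral_add)
        apply (rule iS)
       apply (intro int continuous_intros cu)
      by simp
    with E have "integral {-n..1-n} (\<lambda>x. (bump (x+n))\<^sup>2 * (\<sigma> * W x)) \<le> integral {-n..1-n} ?S"
      by simp
    also have "\<dots> \<le> integral {-n..1-n} (\<lambda>x. M * D x)"
    proof (rule integral_le[OF iS])
      show "(\<lambda>x. M * D x) integrable_on {-n..1-n}"
        unfolding D_def by (intro int continuous_intros cont)
      fix x assume "x \<in> {-n..1-n}"
      then have xn: "x + n \<in> {0..1}" by auto
      have ab: "\<bar>z x\<bar> \<le> 1" "\<bar>z' x\<bar> \<le> 3" "\<bar>y x\<bar> \<le> 1" "\<bar>y' x\<bar> \<le> 3"
      proof -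
        note bb = bump_bounds[OF xn]
        show "\<bar>z x\<bar> \<le> 1" "\<bar>z' x\<bar> \<le> 3" using bb by (auto simp: z_def z'_def)
        show "\<bar>y x\<bar> \<le> 1"
          using bb xn \<sigma> unfolding y_def abs_mult by (auto intro: mult_le_one)
        have "\<bar>(x + n) * bump' (x + n)\<bar> \<le> 1 * 2"
          using bb xn unfolding abs_mult by (intro mult_mono) auto
        then show "\<bar>y' x\<bar> \<le> 3"
          using bb \<sigma> unfolding y'_def by (simp add: abs_mult) (use abs_triangle_ineq[of "bump (x + n)" "(x + n) * bump' (x + n)"] in \<open>simp add: abs_mult\<close>)
      qed
      have sq: "(a * c + b * d)\<^sup>2 \<le> 2 * B\<^sup>2 * (c * c + d * d)" if "\<bar>a\<bar> \<le> B" "\<bar>b\<bar> \<le> B" for a b c d B :: real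
      proof -
        have "(a * c + b * d)\<^sup>2 \<le> 2 * ((a * c)\<^sup>2 + (b * d)\<^sup>2)"
          using sum_squares_bound[of "a*c" "b*d"] by (simp add: power2_sum)
        also have "\<dots> \<le> 2 * (B\<^sup>2 * c\<^sup>2 + B\<^sup>2 * d\<^sup>2)"
          using that by (auto simp: power_mult_distrib abs_le_square_iff[symmetric] intro!: add_mono mult_right_mono)
        finally show ?thesis by (simp add: power2_eq_square algebra_simps)
      qed
      define P where "P = f x * f x + g x * g x"
      define H where "H = h x * h x + k x * k x"
      have PH: "P \<ge> 0" "H \<ge> 0" "D x = P + H" by (auto simp: P_def H_def D_def)
      have s1: "(z' x * f x + y' x * g x)\<^sup>2 \<le> 18 * P"
        using sq[OF ab(2,4), of "f x" "g x"] by (simp add: P_def)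
      have s2: "(u x)\<^sup>2 \<le> 2 * P"
        using sq[OF ab(1,3), of "f x" "g x"] by (simp add: P_def u_def)
      have s3: "(z x * h x + y x * k x)\<^sup>2 \<le> 2 * H"
        using sq[OF ab(1,3), of "h x" "k x"] by (simp add: H_def)
      have s4: "u x * (z x * h x + y x * k x) \<le> P + H"
        using sum_squares_bound[of "u x" "z x * h x + y x * k x"] s2 s3 by linarith
      have "- C * (u x)\<^sup>2 \<le> \<bar>C\<bar> * (u x)\<^sup>2"
        by (intro mult_right_mono) auto
      also have "\<dots> \<le> \<bar>C\<bar> * (2 * P)"
        by (intro mult_left_mono s2) auto
      finally have "?S x \<le> 18 * P + (P + H) + \<bar>C\<bar> * (2 * P)"
        using s1 s4 by linarith
      also have "\<dots> \<le> M * D x"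
        using PH by (simp add: M_def algebra_simps)
      finally show "?S x \<le> M * D x" .
    qed
    also have "\<dots> = M * T n"
      by (simp add: T_def)
    finally show ?thesis .
  qed
  have "w = 0"
  proof (rule ccontr)
    assume "w \<noteq> 0"
    define \<sigma> where "\<sigma> = sgn w"
    have \<sigma>: "\<bar>\<sigma>\<bar> = 1" "\<sigma> * w = \<bar>w\<bar>" using \<open>w \<noteq> 0\<close> by (auto simp: \<sigma>_def sgn_if)
    have "\<forall>\<^sub>F x in at_bot. \<bar>J x\<bar> < \<bar>w\<bar> / 2"
      using tendstoD[OF J0, of "\<bar>w\<bar>/2"] \<open>w \<noteq> 0\<close> by simp
    then obtain X where X: "\<And>x. x \<le> X \<Longrightarrow> \<bar>J x\<bar> < \<bar>w\<bar> / 2"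
      by (auto simp: eventually_at_bot_linorder)
    \<comment> \<open>For these n the window lies to the left of X, where |J| < |w| / 2 leaves at
      least |w| / 2 for sigma W; half of 1/630 is 1/1260.\<close>
    have low: "\<bar>w\<bar> / 1260 \<le> M * T n" if "n \<ge> 1 - X" for n
    proof -
      have "\<bar>w\<bar> / 1260 = integral {-n..1-n} (\<lambda>x. (bump (x+n))\<^sup>2 * (\<bar>w\<bar> / 2))"
        using integral_unique[OF bump_integral, of n] by simp
      also have "\<dots> \<le> integral {-n..1-n} (\<lambda>x. (bump (x+n))\<^sup>2 * (\<sigma> * W x))"
      proof (rule integral_le)
        have c: "continuous_on {-n..1-n} (\<lambda>x. bump (x+n))"
          by (intro continuous_intros continuous_on_compose2[OF continuous_bump(1)[of UNIV]]; simp)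
        show "(\<lambda>x. (bump (x+n))\<^sup>2 * (\<bar>w\<bar> / 2)) integrable_on {-n..1-n}"
          by (intro integrable_continuous_real continuous_intros c)
        show "(\<lambda>x. (bump (x+n))\<^sup>2 * (\<sigma> * W x)) integrable_on {-n..1-n}"
          unfolding W_def
          by (intro integrable_continuous_real continuous_intros c cont[THEN continuous_on_subset]; simp)
        fix x assume "x \<in> {-n..1-n}"
        then have "\<bar>J x\<bar> < \<bar>w\<bar> / 2" using that by (intro X) auto
        moreover have "\<bar>\<sigma> * J x\<bar> = \<bar>J x\<bar>" using \<sigma>(1) by (simp add: abs_mult)
        moreover have "\<sigma> * W x = \<bar>w\<bar> + \<sigma> * J x" using \<sigma>(2) by (simp add: WJ algebra_simps)
        ultimately have "\<bar>w\<bar> / 2 \<le> \<sigma> * W x" by linarith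
        then show "(bump (x+n))\<^sup>2 * (\<bar>w\<bar> / 2) \<le> (bump (x+n))\<^sup>2 * (\<sigma> * W x)"
          by (intro mult_left_mono) auto
      qed
      also have "\<dots> \<le> M * T n" by (rule key[OF \<sigma>(1)])
      finally show ?thesis .
    qed
    have "((\<lambda>n. M * T n) \<longlongrightarrow> M * 0) at_top"
      by (intro tendsto_intros T0)
    moreover have "\<forall>\<^sub>F n in at_top. \<bar>w\<bar> / 1260 \<le> M * T n"
      using eventually_ge_at_top[of "1 - X"] by eventually_elim (rule low)
    ultimately have "\<bar>w\<bar> / 1260 \<le> M * 0"
      by (intro tendsto_lowerbound) auto
    then show False using \<open>w \<noteq> 0\<close> by simp
  qed
  then show ?thesis
    using WJ[of x] by (simp add: W_def J_def)
qed

section \<open>Complex solutions and their pointwise limits\<close>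

definition csol :: "(real \<Rightarrow> real) \<Rightarrow> complex \<Rightarrow> (real \<Rightarrow> complex) \<Rightarrow> (real \<Rightarrow> complex) \<Rightarrow> bool" where
  "csol q lam u u' \<longleftrightarrow> (\<forall>x. (u has_vector_derivative u' x) (at x)) \<and>
     (\<forall>a b. a \<le> b \<longrightarrow> ((\<lambda>s. (complex_of_real (q s) - lam) * u s) has_integral (u' b - u' a)) {a..b})"

lemma is_sol_iff_csol: "is_sol q lam u \<longleftrightarrow> (\<exists>u'. csol q lam u u')"
  by (simp add: is_sol_def csol_def)

lemma csol_continuous:
  assumes "csol q lam u u'"
  shows "continuous_on S u" "continuous_on S u'"
proof -
  have "isCont u x" for x
    using assms has_vector_derivative_continuous unfolding csol_def by blast
  then show "continuous_on S u" by (simp add: continuous_at_imp_continuous_on)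
  have "continuous_on UNIV u'"
    by (rule continuous_of_indefinite_integral) (use assms in \<open>auto simp: csol_def\<close>)
  then show "continuous_on S u'" by (rule continuous_on_subset) simp
qed

section \<open>A priori bounds for solutions on short intervals\<close>

lemma loc_integrable_abs_add:
  assumes "loc_integrable q"
  shows "(\<lambda>x. \<bar>q x\<bar> + L) integrable_on {a..b}"
  using assms by (auto intro!: integrable_add simp: loc_integrable_def absolutely_integrable_on_def)

text \<open>Phrased with a bound \<open>L\<close> on the energy instead of the energy itself, so
  that the constant is common to a whole sequence of solutions with convergent energies.\<close>

lemma csol_deriv_bound:
  assumes q: "loc_integrable q" and u: "csol q lam u u'" and L: "norm lam \<le> L"
    and M: "\<And>x. x \<in> {s..t} \<Longrightarrow> norm (u x) \<le> M" and xc: "x \<in> {s..t}" "c \<in> {s..t}"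
  shows "norm (u' x - u' c) \<le> M * integral {s..t} (\<lambda>x. \<bar>q x\<bar> + L)"
proof -
  let ?p = "\<lambda>x. \<bar>q x\<bar> + L"
  have "L \<ge> 0" using L norm_ge_zero[of lam] by linarith
  have "M \<ge> 0" using M[OF xc(1)] norm_ge_zero[of "u x"] by linarith
  have le: "norm (u' y - u' d) \<le> M * integral {s..t} ?p" if "d \<le> y" "y \<in> {s..t}" "d \<in> {s..t}" for y d
  proof -
    have i: "((\<lambda>s. (complex_of_real (q s) - lam) * u s) has_integral (u' y - u' d)) {d..y}"
      using u that unfolding csol_def by blast
    have "norm (integral {d..y} (\<lambda>s. (complex_of_real (q s) - lam) * u s)) \<le> integral {d..y} (\<lambda>x. M * ?p x)"
    proof (rule integral_norm_bound_integral)
      show "(\<lambda>s. (complex_of_real (q s) - lam) * u s) integrable_on {d..y}"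
        using i by blast
      show "(\<lambda>x. M * ?p x) integrable_on {d..y}"
        by (intro integrable_on_mult_right loc_integrable_abs_add q)
      fix z assume "z \<in> {d..y}"
      then have "norm (u z) \<le> M" using that by (intro M) auto
      moreover have "norm (complex_of_real (q z) - lam) \<le> \<bar>q z\<bar> + L"
        using norm_triangle_ineq4[of "complex_of_real (q z)" lam] L by simp
      ultimately show "norm ((complex_of_real (q z) - lam) * u z) \<le> M * ?p z"
        unfolding norm_mult by (subst mult.commute) (intro mult_mono; use \<open>M \<ge> 0\<close> in simp)
    qed
    also have "\<dots> = M * integral {d..y} ?p" by simp
    also have "\<dots> \<le> M * integral {s..t} ?p"
      using that \<open>L \<ge> 0\<close> \<open>M \<ge> 0\<close>
      by (intro mult_left_mono integral_subset_le loc_integrable_abs_add q) auto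
    finally show ?thesis using integral_unique[OF i] by simp
  qed
  show ?thesis
    using le[of x c] le[of c x] xc by (cases "c \<le> x") (auto simp: norm_minus_commute)
qed

lemma csol_linearization:
  assumes q: "loc_integrable q" and u: "csol q lam u u'" and L: "norm lam \<le> L"
    and M: "\<And>x. x \<in> {s..t} \<Longrightarrow> norm (u x) \<le> M" and xc: "x \<in> {s..t}" "c \<in> {s..t}"
  shows "norm (u x - u c - (x - c) *\<^sub>R u' c) \<le> \<bar>x - c\<bar> * (M * integral {s..t} (\<lambda>x. \<bar>q x\<bar> + L))"
proof -
  have "norm (u x - u c - (x - c) *\<^sub>R u' c) \<le> norm (x - c) * (M * integral {s..t} (\<lambda>x. \<bar>q x\<bar> + L))"
  proof (rule vector_differentiable_bound_linearization[where S="{s..t}"])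
    show "(u has_vector_derivative u' y) (at y within {s..t})" for y
      using u has_vector_derivative_at_within unfolding csol_def by blast
    show "closed_segment c x \<subseteq> {s..t}"
      using xc by (simp add: closed_segment_subset)
    show "norm (u' y - u' c) \<le> M * integral {s..t} (\<lambda>x. \<bar>q x\<bar> + L)" if "y \<in> {s..t}" for y
      using csol_deriv_bound[OF q u L M that xc(2)] .
  qed (use xc in auto)
  then show ?thesis by simp
qed

lemma csol_max:
  assumes "csol q lam u u'" "s \<le> t"
  obtains x where "x \<in> {s..t}" "\<And>y. y \<in> {s..t} \<Longrightarrow> norm (u y) \<le> norm (u x)"
proof -
  have "\<exists>x\<in>{s..t}. \<forall>y\<in>{s..t}. norm (u y) \<le> norm (u x)"
    using assms(2)
    by (intro continuous_attains_sup continuous_on_norm csol_continuous(1)[OF assms(1)]) auto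
  then show ?thesis using that by blast
qed

text \<open>Let M be the maximum of |u|. On a short interval u stays within M/4 of its tangent line
  at s. At t this controls the total rise of the line by |u t| + |u s| + M/4; at the maximum it
  gives M <= |u s| + (|u t| + |u s| + M/4) + M/4, and M is absorbed on the left.\<close>

lemma csol_two_point_bound:
  assumes q: "loc_integrable q" and u: "csol q lam u u'" and L: "norm lam \<le> L" and st: "s \<le> t"
    and small: "(t - s) * integral {s..t} (\<lambda>x. \<bar>q x\<bar> + L) \<le> 1/4" and y: "y \<in> {s..t}"
  shows "norm (u y) \<le> 4 * norm (u s) + 2 * norm (u t)"
proof -
  obtain x where x: "x \<in> {s..t}" "\<And>y. y \<in> {s..t} \<Longrightarrow> norm (u y) \<le> norm (u x)"
    using csol_max[OF u st] by blast
  define M where "M = norm (u x)"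
  have M: "norm (u y) \<le> M" if "y \<in> {s..t}" for y using x that by (simp add: M_def)
  let ?P = "integral {s..t} (\<lambda>x. \<bar>q x\<bar> + L)"
  have "L \<ge> 0" using L norm_ge_zero[of lam] by linarith
  have P: "?P \<ge> 0"
    using \<open>L \<ge> 0\<close> by (intro integral_nonneg loc_integrable_abs_add q) auto
  have "M \<ge> 0" by (simp add: M_def)
  have lin: "norm (u z - u s - (z - s) *\<^sub>R u' s) \<le> M / 4" if "z \<in> {s..t}" for z
  proof -
    have "norm (u z - u s - (z - s) *\<^sub>R u' s) \<le> \<bar>z - s\<bar> * (M * ?P)"
      using csol_linearization[OF q u L M that, of s] st by simp
    also have "\<dots> \<le> (t - s) * (M * ?P)"
      using that P \<open>M \<ge> 0\<close> by (intro mult_right_mono) auto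
    also have "\<dots> \<le> M / 4"
      using mult_left_mono[OF small \<open>M \<ge> 0\<close>] by (simp add: algebra_simps)
    finally show ?thesis .
  qed
  have "norm ((t - s) *\<^sub>R u' s) \<le> norm (u t) + norm (u s) + M / 4"
    using lin[of t] st norm_triangle_ineq4[of "u t - u s" "u t - u s - (t - s) *\<^sub>R u' s"]
      norm_triangle_ineq4[of "u t" "u s"] by simp
  moreover have "norm ((x - s) *\<^sub>R u' s) \<le> norm ((t - s) *\<^sub>R u' s)"
    using x(1) by (auto intro: mult_right_mono)
  moreover have "M \<le> norm (u s) + norm ((x - s) *\<^sub>R u' s) + M / 4"
    using lin[OF x(1)] norm_triangle_ineq[of "u x - u s - (x - s) *\<^sub>R u' s" "u s + (x - s) *\<^sub>R u' s"]
      norm_triangle_ineq[of "u s" "(x - s) *\<^sub>R u' s"] by (simp add: M_def)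
  ultimately have "M \<le> 4 * norm (u s) + 2 * norm (u t)" by linarith
  then show ?thesis using M[OF y] by linarith
qed

lemma small_interval:
  assumes q: "loc_integrable q" and "L \<ge> 0"
  obtains d where "d > 0"
    "\<And>s t. s \<in> {c-d..c+d} \<Longrightarrow> t \<in> {c-d..c+d} \<Longrightarrow> s \<le> t \<Longrightarrow> (t - s) * integral {s..t} (\<lambda>x. \<bar>q x\<bar> + L) \<le> 1/4"
proof -
  let ?p = "\<lambda>x. \<bar>q x\<bar> + L"
  define P where "P = integral {c-1..c+1} ?p"
  have "P \<ge> 0" unfolding P_def
    using \<open>L \<ge> 0\<close> by (intro integral_nonneg loc_integrable_abs_add q) auto
  \<comment> \<open>The greatest length 2 d times P + 1 is then at most 1/4, and the cap 1 keeps
    every interval inside the one that defines P.\<close>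
  define d where "d = min 1 (1 / (8 * (P + 1)))"
  have "d > 0" using \<open>P \<ge> 0\<close> by (simp add: d_def)
  moreover have "(t - s) * integral {s..t} ?p \<le> 1/4"
    if "s \<in> {c-d..c+d}" "t \<in> {c-d..c+d}" "s \<le> t" for s t
  proof -
    have "d \<le> 1" by (simp add: d_def)
    have "integral {s..t} ?p \<le> P"
      unfolding P_def using that \<open>d \<le> 1\<close> \<open>L \<ge> 0\<close>
      by (intro integral_subset_le loc_integrable_abs_add q) auto
    moreover have "integral {s..t} ?p \<ge> 0"
      using \<open>L \<ge> 0\<close> by (intro integral_nonneg loc_integrable_abs_add q) auto
    ultimately have "(t - s) * integral {s..t} ?p \<le> (2 * d) * (P + 1)"
      using that \<open>d > 0\<close> by (intro mult_mono) auto
    also have "\<dots> \<le> 1/4"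
    proof -
      have "d \<le> 1 / (8 * (P + 1))" by (simp add: d_def)
      then show ?thesis using \<open>P \<ge> 0\<close> by (simp add: field_simps)
    qed
    finally show ?thesis .
  qed
  ultimately show ?thesis using that by blast
qed

text \<open>The set of common zeros of u and u' is open and closed.\<close>
lemma csol_unique_0:
  assumes q: "loc_integrable q" and u: "csol q lam u u'" and 0: "u 0 = 0" "u' 0 = 0"
  shows "u x = 0"
proof -
  define Z where "Z = {x. u x = 0} \<inter> {x. u' x = 0}"
  have "closed {x. u x = 0}" "closed {x. u' x = 0}"
    using csol_continuous[OF u, of UNIV] by (auto intro!: closed_Collect_eq)
  then have "closed Z" by (simp add: Z_def closed_Int)
  moreover have "open Z"
    unfolding open_dist
  proof
    fix c assume "c \<in> Z"
    then have c: "u c = 0" "u' c = 0" by (auto simp: Z_def)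
    obtain d where d: "d > 0" "\<And>s t. s \<in> {c-d..c+d} \<Longrightarrow> t \<in> {c-d..c+d} \<Longrightarrow> s \<le> t \<Longrightarrow>
        (t - s) * integral {s..t} (\<lambda>x. \<bar>q x\<bar> + norm lam) \<le> 1/4"
      using small_interval[OF q, of "norm lam" c] by auto
    let ?P = "integral {c-d..c+d} (\<lambda>x. \<bar>q x\<bar> + norm lam)"
    obtain x where x: "x \<in> {c-d..c+d}" "\<And>y. y \<in> {c-d..c+d} \<Longrightarrow> norm (u y) \<le> norm (u x)"
      using csol_max[OF u, of "c-d" "c+d"] d(1) by auto
    have cd: "c \<in> {c-d..c+d}" using d(1) by auto
    have P: "?P \<ge> 0"
      by (intro integral_nonneg loc_integrable_abs_add q) auto
    \<comment> \<open>With zero data at c, the maximum of |u| turns out to be at most a quarter of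
      itself. So u vanishes near c, and the derivative bound with M = 0 gives the same for
      u'.\<close>
    have "norm (u x) \<le> \<bar>x - c\<bar> * (norm (u x) * ?P)"
      using csol_linearization[OF q u order_refl x(2) x(1) cd] c by simp
    also have "\<dots> \<le> (2 * d) * (norm (u x) * ?P)"
      using x(1) P by (intro mult_right_mono) auto
    also have "\<dots> \<le> norm (u x) / 4"
      using mult_left_mono[OF d(2)[of "c-d" "c+d"], of "norm (u x)"] d(1) by (simp add: algebra_simps)
    finally have "norm (u x) = 0" using norm_ge_zero[of "u x"] by linarith
    then have u0: "norm (u y) \<le> 0" if "y \<in> {c-d..c+d}" for y
      using x(2)[OF that] by simp
    moreover have "norm (u' y - u' c) \<le> 0" if "y \<in> {c-d..c+d}" for y
      using csol_deriv_bound[OF q u order_refl u0 that cd] by simp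
    ultimately have "y \<in> Z" if "y \<in> {c-d..c+d}" for y
      using that c by (simp add: Z_def)
    then show "\<exists>e>0. \<forall>y. dist y c < e \<longrightarrow> y \<in> Z"
      using d(1) by (intro exI[of _ d]) (auto simp: dist_real_def abs_less_iff)
  qed
  moreover have "0 \<in> Z" using 0 by (simp add: Z_def)
  ultimately have "Z = UNIV" using clopen[of Z] by blast
  then show ?thesis by (auto simp: Z_def)
qed

text \<open>Around each point there are short intervals on which the values at the two ends bound
  the whole solution, and at a fixed point a convergent sequence is bounded. Bisection joins these
  local bounds over a compact interval.\<close>

lemma csol_locally_uniform_bound:
  fixes F :: "nat \<Rightarrow> real \<Rightarrow> complex"
  assumes q: "loc_integrable q" and sol: "\<And>n. csol q (lam n) (F n) (F' n)"
    and L: "\<And>n. norm (lam n) \<le> L" and conv: "\<And>x. convergent (\<lambda>n. F n x)" and "a \<le> b"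
  shows "\<exists>B. \<forall>n. \<forall>x\<in>{a..b}. norm (F n x) \<le> B"
  using \<open>a \<le> b\<close>
proof (induction a b rule: Bolzano)
  case (trans a b c)
  then obtain B1 B2 where "\<And>n x. x \<in> {a..b} \<Longrightarrow> norm (F n x) \<le> B1"
      "\<And>n x. x \<in> {b..c} \<Longrightarrow> norm (F n x) \<le> B2" by blast
  then have "norm (F n x) \<le> max B1 B2" if "x \<in> {a..c}" for n x
    using that by (cases "x \<le> b") (force simp: le_max_iff_disj)+
  then show ?case by blast
next
  case (local x)
  have "L \<ge> 0" using L[of 0] norm_ge_zero[of "lam 0"] by linarith
  then obtain d where d: "d > 0" "\<And>s t. s \<in> {x-d..x+d} \<Longrightarrow> t \<in> {x-d..x+d} \<Longrightarrow> s \<le> t \<Longrightarrow>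
        (t - s) * integral {s..t} (\<lambda>x. \<bar>q x\<bar> + L) \<le> 1/4"
    using small_interval[OF q, of L x] by auto
  have "\<exists>B. \<forall>n. \<forall>y\<in>{s..t}. norm (F n y) \<le> B" if st: "s \<le> x" "x \<le> t" "t - s < d" for s t
  proof -
    obtain B1 B2 where B: "\<And>n. norm (F n s) \<le> B1" "\<And>n. norm (F n t) \<le> B2"
      using convergent_imp_Bseq[OF conv] by (metis BseqE)
    have "norm (F n y) \<le> 4 * B1 + 2 * B2" if "y \<in> {s..t}" for n y
      using csol_two_point_bound[OF q sol L _ d(2) that, of n] st B(1)[of n] B(2)[of n] by force
    then show ?thesis by blast
  qed
  then show ?case using d(1) by blast
qed

text \<open>Pointwise convergence suffices: by the two-point bound the solutions are locally uniformly bounded,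
  and F' n s is recovered from F n s, F n (s + 1) and integrals that converge dominatedly.\<close>
theorem csol_limit:
  fixes F :: "nat \<Rightarrow> real \<Rightarrow> complex"
  assumes q: "loc_integrable q" and sol: "\<And>n. csol q (lam n) (F n) (F' n)"
    and lam: "lam \<longlonglongrightarrow> l" and conv: "\<And>x. (\<lambda>n. F n x) \<longlonglongrightarrow> f x"
  obtains f' where "csol q l f f'" "\<And>x. (\<lambda>n. F' n x) \<longlonglongrightarrow> f' x"
proof -
  have "Bseq lam" using lam by (auto intro: convergent_imp_Bseq convergentI)
  then obtain L where L: "\<And>n. norm (lam n) \<le> L" by (metis BseqE)
  have bdd: "\<exists>B. \<forall>n. \<forall>x\<in>{a..b}. norm (F n x) \<le> B" if "a \<le> b" for a b
    by (rule csol_locally_uniform_bound[OF q sol L convergentI[OF conv] that])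
  let ?k = "\<lambda>n x. (complex_of_real (q x) - lam n) * F n x"
  let ?kl = "\<lambda>x. (complex_of_real (q x) - l) * f x"
  have ki: "(?k n has_integral F' n b - F' n a) {a..b}" if "a \<le> b" for n a b
    using sol that by (auto simp: csol_def)
  have lim_k: "?kl integrable_on {a..b} \<and> (\<lambda>n. F' n b - F' n a) \<longlonglongrightarrow> integral {a..b} ?kl" if ab: "a \<le> b" for a b
  proof -
    obtain B where B: "\<And>n x. x \<in> {a..b} \<Longrightarrow> norm (F n x) \<le> B" using bdd[OF ab] by blast
    have "B \<ge> 0" using B[of a 0] ab norm_ge_zero[of "F 0 a"] by (meson atLeastAtMost_iff order_refl order_trans)
    have dom: "norm (?k n x) \<le> (\<bar>q x\<bar> + L) * B" if "x \<in> {a..b}" for n x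
      unfolding norm_mult using B[OF that, of n] L[of n] norm_triangle_ineq4[of "complex_of_real (q x)" "lam n"]
      by (intro mult_mono) (auto simp: add_nonneg_nonneg order.trans[OF norm_ge_zero L])
    have "?k n integrable_on {a..b}" for n using ki[OF ab] by blast
    moreover have "(\<lambda>x. (\<bar>q x\<bar> + L) * B) integrable_on {a..b}"
      by (intro integrable_on_mult_left loc_integrable_abs_add q)
    moreover have "(\<lambda>n. ?k n x) \<longlonglongrightarrow> ?kl x" for x
      by (intro tendsto_intros lam conv)
    ultimately have "?kl integrable_on {a..b}" "(\<lambda>n. integral {a..b} (?k n)) \<longlonglongrightarrow> integral {a..b} ?kl"
      using dominated_convergence[of ?k "{a..b}" _ ?kl, OF _ _ dom] by blast+
    then show ?thesis
      using integral_unique[OF ki[OF ab]] by simp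
  qed
  have bdd': "\<exists>B. \<forall>n. \<forall>x\<in>{a..b}. norm (F' n x - F' n a) \<le> B" if ab: "a \<le> b" for a b
  proof -
    obtain B where B: "\<And>n x. x \<in> {a..b} \<Longrightarrow> norm (F n x) \<le> B" using bdd[OF ab] by blast
    have "norm (F' n x - F' n a) \<le> B * integral {a..b} (\<lambda>x. \<bar>q x\<bar> + L)" if "x \<in> {a..b}" for n x
      using csol_deriv_bound[OF q sol L B that, of a] ab by simp
    then show ?thesis by blast
  qed
  have F'i: "(F' n has_integral F n b - F n a) {a..b}" if "a \<le> b" for n a b
    using sol[of n] that has_vector_derivative_at_within unfolding csol_def
    by (intro fundamental_theorem_of_calculus) blast+
  have "convergent (\<lambda>n. F' n s)" for s
  proof -
    let ?I = "\<lambda>x. integral {s..x} ?kl"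
    have "s \<le> s + 1" by simp
    then obtain B where B: "\<And>n x. x \<in> {s..s+1} \<Longrightarrow> norm (F' n x - F' n s) \<le> B" using bdd' by blast
    \<comment> \<open>The unit length gives \<open>F' n s\<close> the coefficient 1 in the
      integral.\<close>
    have i: "((\<lambda>x. F' n x - F' n s) has_integral (F n (s+1) - F n s - F' n s)) {s..s+1}" for n
      using has_integral_diff[OF F'i[of s "s+1" n] has_integral_const_real[of "F' n s" s "s+1"]] by simp
    have "(\<lambda>n. integral {s..s+1} (\<lambda>x. F' n x - F' n s)) \<longlonglongrightarrow> integral {s..s+1} ?I"
    proof (rule dominated_convergence(2)[where h="\<lambda>_. B"]; (rule B)?)
      show "(\<lambda>x. F' n x - F' n s) integrable_on {s..s+1}" for n using i by blast
      show "(\<lambda>n. F' n x - F' n s) \<longlonglongrightarrow> ?I x" if "x \<in> {s..s+1}" for x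
        using lim_k[of s x] that by simp
    qed auto
    then have "(\<lambda>n. F n (s+1) - F n s - F' n s) \<longlonglongrightarrow> integral {s..s+1} ?I"
      using integral_unique[OF i] by simp
    then have "(\<lambda>n. (F n (s+1) - F n s) - (F n (s+1) - F n s - F' n s)) \<longlonglongrightarrow> (f (s+1) - f s) - integral {s..s+1} ?I"
      by (intro tendsto_intros conv)
    then show ?thesis by (auto intro: convergentI)
  qed
  then obtain f' where f': "\<And>x. (\<lambda>n. F' n x) \<longlonglongrightarrow> f' x"
    unfolding convergent_def by metis
  have k0i: "(?kl has_integral f' b - f' a) {a..b}" if "a \<le> b" for a b
  proof -
    have "(\<lambda>n. F' n b - F' n a) \<longlonglongrightarrow> f' b - f' a" by (intro tendsto_intros f')
    with lim_k[OF that] have "integral {a..b} ?kl = f' b - f' a"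
      using LIMSEQ_unique by blast
    then show ?thesis using lim_k[OF that] integrable_integral by metis
  qed
  have cf': "continuous_on UNIV f'"
    by (rule continuous_of_indefinite_integral[OF k0i])
  \<comment> \<open>Differentiability of f comes from passing to the limit in the integrated
    relation and then differentiating the integral of the continuous f'.\<close>
  have f'i: "integral {a..b} f' = f b - f a" if ab: "a \<le> b" for a b
  proof -
    obtain B where B: "\<And>n x. x \<in> {a..b} \<Longrightarrow> norm (F' n x - F' n a) \<le> B" using bdd'[OF ab] by blast
    obtain B2 where B2: "\<And>n. norm (F' n a) \<le> B2"
      using convergent_imp_Bseq[OF convergentI[OF f']] by (metis BseqE)
    have BB: "norm (F' n x) \<le> B + B2" if "x \<in> {a..b}" for n x
      using B[OF that, of n] B2[of n] norm_triangle_ineq[of "F' n x - F' n a" "F' n a"] by simp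
    have "(\<lambda>n. integral {a..b} (F' n)) \<longlonglongrightarrow> integral {a..b} f'"
    proof (rule dominated_convergence(2)[where h="\<lambda>_. B + B2"]; (rule BB)?)
      show "F' n integrable_on {a..b}" for n using F'i[OF ab] by blast
    qed (auto intro: f')
    moreover have "(\<lambda>n. F n b - F n a) \<longlonglongrightarrow> f b - f a" by (intro tendsto_intros conv)
    ultimately show ?thesis
      using integral_unique[OF F'i[OF ab]] LIMSEQ_unique by auto
  qed
  have "(f has_vector_derivative f' x) (at x)" for x
  proof -
    let ?S = "{x-1<..<x+1}"
    have "((\<lambda>u. integral {x-1..u} f') has_vector_derivative f' x) (at x within {x-1..x+1})"
      by (rule integral_has_vector_derivative) (use cf' continuous_on_subset in auto)
    then have "((\<lambda>u. integral {x-1..u} f') has_vector_derivative f' x) (at x within ?S)"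
      by (rule has_vector_derivative_within_subset) auto
    then have "((\<lambda>u. integral {x-1..u} f') has_vector_derivative f' x) (at x)"
      by (simp add: at_within_open[of x ?S])
    then have "((\<lambda>u. f (x-1) + integral {x-1..u} f') has_vector_derivative 0 + f' x) (at x)"
      by (intro derivative_intros)
    then show ?thesis
      unfolding add_0
      by (rule has_vector_derivative_transform_within_open[where S="?S"]) (auto simp: f'i)
  qed
  then have "csol q l f f'" using k0i by (simp add: csol_def)
  then show ?thesis using that f' by blast
qed

section \<open>Boundary values of Weyl solutions\<close>

lemma csol_cmult:
  assumes "csol q lam u u'"
  shows "csol q lam (\<lambda>x. c * u x) (\<lambda>x. c * u' x)"
  unfolding csol_def
proof (intro conjI allI impI)
  show "((\<lambda>x. c * u x) has_vector_derivative c * u' x) (at x)" for x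
    using assms by (auto simp: csol_def intro: has_vector_derivative_mult_right)
  fix a b :: real assume "a \<le> b"
  with assms have "((\<lambda>s. c * ((complex_of_real (q s) - lam) * u s)) has_integral c * (u' b - u' a)) {a..b}"
    unfolding csol_def by (intro has_integral_mult_right) blast
  then show "((\<lambda>s. (complex_of_real (q s) - lam) * (c * u s)) has_integral c * u' b - c * u' a) {a..b}"
    by (simp add: algebra_simps)
qed

lemma loc_integrable_mult_continuous:
  assumes "loc_integrable q" "continuous_on UNIV f"
  shows "(\<lambda>x. q x * f x) absolutely_integrable_on {a..b}"
proof -
  have "(\<lambda>x. f x * q x) absolutely_integrable_on {a..b}"
    using assms by (intro absolutely_integrable_continuous_mult)
      (auto simp: loc_integrable_def intro: continuous_on_subset)
  then show ?thesis by (simp add: mult.commute)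
qed

lemma csol_Re:
  assumes q: "loc_integrable q" and u: "csol q lam u u'"
  shows "rsol q (\<lambda>x. Re lam * Re (u x) - Im lam * Im (u x)) (\<lambda>x. Re (u x)) (\<lambda>x. Re (u' x))"
  unfolding rsol_def indef_int_def
proof (intro conjI allI impI)
  show "((\<lambda>x. Re (u x)) has_real_derivative Re (u' x)) (at x)" for x
    using u bounded_linear.has_vector_derivative[OF bounded_linear_Re]
    unfolding csol_def has_real_derivative_iff_has_vector_derivative by blast
  fix a b :: real assume ab: "a \<le> b"
  have c: "continuous_on UNIV (\<lambda>x. Re (u x))" "continuous_on UNIV (\<lambda>x. Im (u x))"
    by (intro continuous_intros csol_continuous[OF u])+
  have "(\<lambda>s. Re lam * Re (u s) - Im lam * Im (u s)) absolutely_integrable_on {a..b}"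
    by (intro absolutely_integrable_continuous_real continuous_intros c[THEN continuous_on_subset]) auto
  from set_integral_diff(1)[OF loc_integrable_mult_continuous[OF q c(1)] this]
  show "(\<lambda>s. q s * Re (u s) - (Re lam * Re (u s) - Im lam * Im (u s))) absolutely_integrable_on {a..b}" .
  have "((\<lambda>s. (complex_of_real (q s) - lam) * u s) has_integral (u' b - u' a)) {a..b}"
    using u ab by (auto simp: csol_def)
  from has_integral_linear[OF this bounded_linear_Re]
  show "((\<lambda>s. q s * Re (u s) - (Re lam * Re (u s) - Im lam * Im (u s))) has_integral Re (u' b) - Re (u' a)) {a..b}"
    by (simp add: o_def algebra_simps)
qed

lemma csol_Im:
  assumes q: "loc_integrable q" and u: "csol q lam u u'"
  shows "rsol q (\<lambda>x. Re lam * Im (u x) + Im lam * Re (u x)) (\<lambda>x. Im (u x)) (\<lambda>x. Im (u' x))"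
  \<comment> \<open>Im u is the real part of - i u, which solves the same equation.\<close>
  using csol_Re[OF q csol_cmult[OF u, where c="-\<i>"]] by simp

lemma rsol_csol:
  assumes "rsol q (\<lambda>x. l * f x) f f'"
  shows "csol q (complex_of_real l) (\<lambda>x. complex_of_real (f x)) (\<lambda>x. complex_of_real (f' x))"
  unfolding csol_def
proof (intro conjI allI impI)
  show "((\<lambda>x. complex_of_real (f x)) has_vector_derivative complex_of_real (f' x)) (at x)" for x
    using assms bounded_linear.has_vector_derivative[OF bounded_linear_of_real]
    unfolding rsol_def has_real_derivative_iff_has_vector_derivative by blast
  fix a b :: real assume "a \<le> b"
  then have "((\<lambda>s. q s * f s - l * f s) has_integral f' b - f' a) {a..b}"
    using assms by (auto simp: rsol_def indef_int_def)
  from has_integral_linear[OF this bounded_linear_of_real[where 'a=complex]]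
  show "((\<lambda>s. (complex_of_real (q s) - complex_of_real l) * complex_of_real (f s))
      has_integral complex_of_real (f' b) - complex_of_real (f' a)) {a..b}"
    by (simp add: o_def algebra_simps)
qed

lemma rsol_unique_0:
  assumes "loc_integrable q" "rsol q (\<lambda>x. l * f x) f f'" "f 0 = 0" "f' 0 = 0"
  shows "f x = 0"
  using csol_unique_0[OF assms(1) rsol_csol[OF assms(2)]] assms(3,4) by simp

text \<open>The Wronskian of Re u and Im u at 0 is - Im lam times the squared L2-norm of u on the left.
  Hence the norm of u in the Cauchy-Schwarz estimate (here AM-GM with the weight delta) is under
  control even as Im lam tends to 0.\<close>
lemma weyl_wronskian_bound:
  assumes sb: "semibounded q" and q: "loc_integrable q"
    and u: "csol q lam u u'" and L2u: "L2_left u"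
    and g: "rsol q (\<lambda>x. l * g x) g g'" and L2g: "L2_left g"
    and b: "0 \<le> Im lam" "\<bar>Re lam - l\<bar> \<le> Im lam" and "\<delta> > 0"
  shows "\<bar>Re (u 0) * g' 0 - Re (u' 0) * g 0\<bar>
    \<le> \<delta> * \<bar>Re (u 0) * Im (u' 0) - Re (u' 0) * Im (u 0)\<bar> + Im lam / (2 * \<delta>) * integral {..0} (\<lambda>x. g x * g x)"
proof -
  define \<alpha> where "\<alpha> = Re lam"
  define \<beta> where "\<beta> = Im lam"
  define f1 where "f1 x = Re (u x)" for x
  define f2 where "f2 x = Im (u x)" for x
  have c: "continuous_on UNIV f1" "continuous_on UNIV f2" "continuous_on UNIV g"
    unfolding f1_def f2_def by (intro continuous_intros csol_continuous[OF u] rsol_continuous[OF g])+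
  have L: "L2_left f1" "L2_left f2"
    using c(1,2) L2u by (auto intro!: L2_left_continuousI[where g=u] simp: f1_def f2_def abs_Re_le_cmod abs_Im_le_cmod)
  have h1: "rsol q (\<lambda>x. \<alpha> * f1 x + (-\<beta>) * f2 x) f1 (\<lambda>x. Re (u' x))"
    using csol_Re[OF q u] by (simp add: f1_def[abs_def] f2_def \<alpha>_def \<beta>_def)
  have h2: "rsol q (\<lambda>x. \<alpha> * f2 x + \<beta> * f1 x) f2 (\<lambda>x. Im (u' x))"
    using csol_Im[OF q u] by (simp add: f1_def f2_def[abs_def] \<alpha>_def \<beta>_def)
  note L' = L2_left_add[OF L2_left_cmult L2_left_cmult]
  have "f1 0 * Im (u' 0) - Re (u' 0) * f2 0
      = integral {..0} (\<lambda>s. (\<alpha> * f1 s + (-\<beta>) * f2 s) * f2 s - f1 s * (\<alpha> * f2 s + \<beta> * f1 s))"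
    by (intro wronskian_left[OF sb h1 h2] continuous_intros c L L')
  also have "\<dots> = integral {..0} (\<lambda>s. -\<beta> * (f1 s * f1 s + f2 s * f2 s))"
    by (simp add: algebra_simps)
  finally have W12: "f1 0 * Im (u' 0) - Re (u' 0) * f2 0 = -\<beta> * integral {..0} (\<lambda>s. f1 s * f1 s + f2 s * f2 s)"
    by (simp only: integral_mult_right)
  have W1g: "f1 0 * g' 0 - Re (u' 0) * g 0
      = integral {..0} (\<lambda>s. (\<alpha> * f1 s + (-\<beta>) * f2 s) * g s - f1 s * (l * g s))"
    by (intro wronskian_left[OF sb h1 g] continuous_intros c L L' L2g L2_left_cmult)
  note si = set_integral_add(1) set_integral_diff(1) L2_left_mult_set_integrable set_integrable_mult_right
  have i1: "(\<lambda>s. (\<alpha> * f1 s + (-\<beta>) * f2 s) * g s - f1 s * (l * g s)) integrable_on {..0}"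
    by (intro integral_left_tail(1) si L L' L2g L2_left_cmult)
  have i2: "(\<lambda>s. f1 s * f1 s + f2 s * f2 s) integrable_on {..0}" "(\<lambda>s. g s * g s) integrable_on {..0}"
    by (intro integral_left_tail(1) si L L2g)+
  have i3: "(\<lambda>s. \<beta> * \<delta> * (f1 s * f1 s + f2 s * f2 s) + \<beta> / (2 * \<delta>) * (g s * g s)) integrable_on {..0}"
    by (intro integrable_add integrable_on_mult_right i2)
  \<comment> \<open>Applied once with Re u and once with Im u; the two weights 1 / (4 delta) add up
    to the 1 / (2 delta) of the conclusion.\<close>
  have amgm: "\<bar>x * y\<bar> \<le> \<delta> * (x * x) + 1 / (4 * \<delta>) * (y * y)" for x y
  proof -
    have "0 \<le> (2 * \<delta> * \<bar>x\<bar> - \<bar>y\<bar>)\<^sup>2" by simp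
    then have "4 * \<delta> * \<bar>x * y\<bar> \<le> 4 * \<delta> * (\<delta> * (x * x)) + y * y"
      by (simp add: power2_eq_square abs_mult algebra_simps)
    then show ?thesis using \<open>\<delta> > 0\<close> by (simp add: field_simps)
  qed
  have "\<bar>f1 0 * g' 0 - Re (u' 0) * g 0\<bar>
     \<le> integral {..0} (\<lambda>s. \<beta> * \<delta> * (f1 s * f1 s + f2 s * f2 s) + \<beta> / (2 * \<delta>) * (g s * g s))"
    unfolding W1g real_norm_def[symmetric]
  proof (rule integral_norm_bound_integral[OF i1 i3])
    fix s
    have "\<bar>(\<alpha> * f1 s + (-\<beta>) * f2 s) * g s - f1 s * (l * g s)\<bar> = \<bar>(\<alpha> - l) * (f1 s * g s) - \<beta> * (f2 s * g s)\<bar>"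
      by (simp add: algebra_simps)
    also have "\<dots> \<le> \<bar>\<alpha> - l\<bar> * \<bar>f1 s * g s\<bar> + \<beta> * \<bar>f2 s * g s\<bar>"
      using abs_triangle_ineq4[of "(\<alpha> - l) * (f1 s * g s)" "\<beta> * (f2 s * g s)"] b(1)
      by (simp add: abs_mult \<beta>_def)
    \<comment> \<open>The hypothesis on Re lam - l makes Im lam the common factor of both terms, and
      Im lam times the squared norm is what the Wronskian at 0 controls.\<close>
    also have "\<dots> \<le> \<beta> * \<bar>f1 s * g s\<bar> + \<beta> * \<bar>f2 s * g s\<bar>"
      using b(2) by (intro add_right_mono mult_right_mono) (auto simp: \<alpha>_def \<beta>_def)
    also have "\<dots> \<le> \<beta> * (\<delta> * (f1 s * f1 s) + 1 / (4 * \<delta>) * (g s * g s))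
        + \<beta> * (\<delta> * (f2 s * f2 s) + 1 / (4 * \<delta>) * (g s * g s))"
      using b(1) by (intro add_mono mult_left_mono amgm) (auto simp: \<beta>_def)
    also have "\<dots> = \<beta> * \<delta> * (f1 s * f1 s + f2 s * f2 s) + \<beta> / (2 * \<delta>) * (g s * g s)"
      by (simp add: field_simps)
    finally show "norm ((\<alpha> * f1 s + (-\<beta>) * f2 s) * g s - f1 s * (l * g s))
        \<le> \<beta> * \<delta> * (f1 s * f1 s + f2 s * f2 s) + \<beta> / (2 * \<delta>) * (g s * g s)"
      by simp
  qed
  also have "\<dots> = \<beta> * \<delta> * integral {..0} (\<lambda>s. f1 s * f1 s + f2 s * f2 s) + \<beta> / (2 * \<delta>) * integral {..0} (\<lambda>x. g x * g x)"
    by (subst Henstock_Kurzweil_Integration.integral_add)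
       (intro integrable_on_mult_right i2 | simp only: integral_mult_right)+
  also have "\<beta> * \<delta> * integral {..0} (\<lambda>s. f1 s * f1 s + f2 s * f2 s) \<le> \<delta> * \<bar>f1 0 * Im (u' 0) - Re (u' 0) * f2 0\<bar>"
    unfolding W12 using \<open>\<delta> > 0\<close> abs_ge_minus_self[of "- \<beta> * integral {..0} (\<lambda>s. f1 s * f1 s + f2 s * f2 s)"]
    by simp
  finally show ?thesis
    by (simp add: f1_def f2_def \<beta>_def)
qed

lemma L2_left_cmult_complex:
  fixes f :: "real \<Rightarrow> complex"
  assumes "L2_left f"
  shows "L2_left (\<lambda>x. c * f x)"
  using assms by (auto simp: L2_left_def power_mult_distrib norm_mult)

text \<open>In the bound for the approximants the limit in n comes first and removes the term with
  Im lam; letting delta tend to 0 then removes the other one. The bound sees only real parts, so the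
  solutions are first multiplied by a constant c, which recovers the imaginary part as well.\<close>

theorem left_weyl_bv_wronskian:
  assumes sb: "semibounded q" and q: "loc_integrable q" and "k > 0"
    and bv: "left_weyl_bv q k \<phi>"
    and g: "rsol q (\<lambda>x. k\<^sup>2 * g x) g g'" and L2g: "L2_left g"
  obtains \<phi>' where "csol q (complex_of_real (k\<^sup>2)) \<phi> \<phi>'"
    "\<phi> 0 * complex_of_real (g' 0) = \<phi>' 0 * complex_of_real (g 0)"
proof -
  obtain \<Phi> where ev: "\<forall>\<^sub>F \<epsilon> in at_right 0. weyl_left q (complex_of_real k + \<i> * complex_of_real \<epsilon>) (\<Phi> \<epsilon>)"
    and lim: "\<And>x. ((\<lambda>\<epsilon>. \<Phi> \<epsilon> x) \<longlongrightarrow> \<phi> x) (at_right 0)"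
    using bv unfolding left_weyl_bv_def by blast
  obtain d where d: "d > 0" "\<And>\<epsilon>. 0 < \<epsilon> \<Longrightarrow> \<epsilon> < d \<Longrightarrow> weyl_left q (complex_of_real k + \<i> * complex_of_real \<epsilon>) (\<Phi> \<epsilon>)"
    using ev by (auto simp: eventually_at_right_field)
  \<comment> \<open>Below d the Weyl solution exists. Below k one has e^2 <= 2 k e, that is, |Re lam
    - k^2| <= Im lam, as the bound requires. The offset 2 makes both inequalities strict already for
    n = 0.\<close>
  define e where "e n = min d k / (real n + 2)" for n
  have e: "0 < e n" "e n < d" "e n < k" for n
  proof -
    have "min d k > 0" using d(1) \<open>k > 0\<close> by simp
    then show "0 < e n" by (simp add: e_def)
    have "e n < min d k"
      using \<open>min d k > 0\<close> unfolding e_def by (simp only: divide_less_eq) (auto simp: algebra_simps add_pos_nonneg)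
    then show "e n < d" "e n < k" by auto
  qed
  have e0: "e \<longlonglongrightarrow> 0"
    unfolding e_def by real_asymp
  then have er: "filterlim e (at_right 0) sequentially"
    using e(1) by (intro tendsto_imp_filterlim_at_right) auto
  define F where "F n = \<Phi> (e n)" for n
  define lam where "lam n = (complex_of_real k + \<i> * complex_of_real (e n))\<^sup>2" for n
  have w: "weyl_left q (complex_of_real k + \<i> * complex_of_real (e n)) (F n)" for n
    unfolding F_def using d(2) e by blast
  then have "\<exists>F'. csol q (lam n) (F n) F'" for n
    by (simp add: weyl_left_def is_sol_iff_csol lam_def)
  then obtain F' where F': "\<And>n. csol q (lam n) (F n) (F' n)" by metis
  have L2F: "L2_left (F n)" for n using w by (simp add: weyl_left_def)
  have conv: "(\<lambda>n. F n x) \<longlonglongrightarrow> \<phi> x" for x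
    unfolding F_def by (rule filterlim_compose[OF lim er])
  have "lam \<longlonglongrightarrow> (complex_of_real k + \<i> * complex_of_real 0)\<^sup>2"
    unfolding lam_def by (intro tendsto_intros e0)
  then have "lam \<longlonglongrightarrow> complex_of_real (k\<^sup>2)" by simp
  from csol_limit[OF q F' this conv] obtain \<phi>' where \<phi>': "csol q (complex_of_real (k\<^sup>2)) \<phi> \<phi>'"
    "\<And>x. (\<lambda>n. F' n x) \<longlonglongrightarrow> \<phi>' x" by blast
  have lam_ri: "Re (lam n) = k\<^sup>2 - (e n)\<^sup>2" "Im (lam n) = 2 * k * e n" for n
    by (auto simp: lam_def power2_eq_square)
  have Re0: "Re (c * \<phi> 0) * g' 0 - Re (c * \<phi>' 0) * g 0 = 0" for c
  proof -
    let ?A = "\<bar>Re (c * \<phi> 0) * g' 0 - Re (c * \<phi>' 0) * g 0\<bar>"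
    let ?B = "\<bar>Re (c * \<phi> 0) * Im (c * \<phi>' 0) - Re (c * \<phi>' 0) * Im (c * \<phi> 0)\<bar>"
    have AB: "?A \<le> \<delta> * ?B" if "\<delta> > 0" for \<delta>
    proof -
      have "?A \<le> \<delta> * ?B + (2 * k * 0) / (2 * \<delta>) * integral {..0} (\<lambda>x. g x * g x)"
      proof (rule tendsto_le)
        show "(\<lambda>n. \<bar>Re (c * F n 0) * g' 0 - Re (c * F' n 0) * g 0\<bar>) \<longlonglongrightarrow> ?A"
          by (intro tendsto_intros conv \<phi>'(2))
        show "(\<lambda>n. \<delta> * \<bar>Re (c * F n 0) * Im (c * F' n 0) - Re (c * F' n 0) * Im (c * F n 0)\<bar>
            + (2 * k * e n) / (2 * \<delta>) * integral {..0} (\<lambda>x. g x * g x))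
          \<longlonglongrightarrow> \<delta> * ?B + (2 * k * 0) / (2 * \<delta>) * integral {..0} (\<lambda>x. g x * g x)"
          using that by (intro tendsto_intros conv \<phi>'(2) e0) auto
        show "\<forall>\<^sub>F n in sequentially. \<bar>Re (c * F n 0) * g' 0 - Re (c * F' n 0) * g 0\<bar>
          \<le> \<delta> * \<bar>Re (c * F n 0) * Im (c * F' n 0) - Re (c * F' n 0) * Im (c * F n 0)\<bar>
            + (2 * k * e n) / (2 * \<delta>) * integral {..0} (\<lambda>x. g x * g x)"
        proof (intro always_eventually allI)
          fix n
          have "e n * e n \<le> 2 * k * e n"
            using e[of n] by (intro mult_right_mono) auto
          then have "0 \<le> Im (lam n)" "\<bar>Re (lam n) - k\<^sup>2\<bar> \<le> Im (lam n)"
            using e(1)[of n] \<open>k > 0\<close> by (auto simp: lam_ri power2_eq_square)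
          from weyl_wronskian_bound[OF sb q csol_cmult[OF F', where c=c] L2_left_cmult_complex[OF L2F] g L2g this that]
          show "\<bar>Re (c * F n 0) * g' 0 - Re (c * F' n 0) * g 0\<bar>
            \<le> \<delta> * \<bar>Re (c * F n 0) * Im (c * F' n 0) - Re (c * F' n 0) * Im (c * F n 0)\<bar>
              + (2 * k * e n) / (2 * \<delta>) * integral {..0} (\<lambda>x. g x * g x)"
            unfolding lam_ri .
        qed
      qed simp
      then show ?thesis by simp
    qed
    have "?A \<le> 0"
    proof (rule field_le_epsilon)
      fix \<epsilon> :: real assume "\<epsilon> > 0"
      have "?A \<le> \<epsilon> / (?B + 1) * ?B" using \<open>\<epsilon> > 0\<close> by (intro AB) auto
      also have "\<dots> \<le> \<epsilon>" using \<open>\<epsilon> > 0\<close> by (simp add: field_simps add_pos_nonneg)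
      finally show "?A \<le> 0 + \<epsilon>" by simp
    qed
    then show ?thesis by simp
  qed
  \<comment> \<open>c = 1 gives the real part of the identity, c = - i the imaginary part.\<close>
  have "\<phi> 0 * complex_of_real (g' 0) = \<phi>' 0 * complex_of_real (g 0)"
    using Re0[of 1] Re0[of "-\<i>"] by (auto simp: complex_eq_iff)
  with \<phi>'(1) show ?thesis using that by blast
qed

section \<open>The functions phiN\<close>

lemma rsol_add_cmult:
  assumes "rsol q h f f'" "rsol q k g g'"
  shows "rsol q (\<lambda>x. h x + c * k x) (\<lambda>x. f x + c * g x) (\<lambda>x. f' x + c * g' x)"
  unfolding rsol_def
proof (intro conjI allI)
  show "((\<lambda>x. f x + c * g x) has_real_derivative f' x + c * g' x) (at x)" for x
    using assms unfolding rsol_def by (auto intro!: derivative_eq_intros)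
  have "indef_int (\<lambda>x. (q x * f x - h x) + c * (q x * g x - k x)) (\<lambda>x. f' x + c * g' x)"
    using assms unfolding rsol_def by (intro indef_int_add indef_int_cmult) auto
  then show "indef_int (\<lambda>x. q x * (f x + c * g x) - (h x + c * k x)) (\<lambda>x. f' x + c * g' x)"
    by (simp add: algebra_simps)
qed

lemma rsol_proportional:
  assumes q: "loc_integrable q" and f: "rsol q (\<lambda>x. l * f x) f f'" and g: "rsol q (\<lambda>x. l * g x) g g'"
    and W: "f 0 * g' 0 = f' 0 * g 0" and nz: "f 0 \<noteq> 0 \<or> f' 0 \<noteq> 0"
  obtains c where "g = (\<lambda>x. c * f x)"
proof -
  obtain c where c: "g 0 = c * f 0" "g' 0 = c * f' 0"
  proof (cases "f 0 = 0")
    case True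
    then show ?thesis using that[of "g' 0 / f' 0"] W nz by (auto simp: field_simps)
  next
    case False
    then show ?thesis using that[of "g 0 / f 0"] W nz by (auto simp: field_simps)
  qed
  have "rsol q (\<lambda>x. l * (g x + (-c) * f x)) (\<lambda>x. g x + (-c) * f x) (\<lambda>x. g' x + (-c) * f' x)"
    using rsol_add_cmult[OF g f, of "-c"] by (simp add: algebra_simps)
  from rsol_unique_0[OF q this] c have "g x + (-c) * f x = 0" for x by simp
  then show ?thesis using that[of c] by (auto simp: fun_eq_iff)
qed

text \<open>As q and l are real, Re u and Im u solve the same equation, and by uniqueness at least
  one of them has nonzero Cauchy data at 0.\<close>

lemma real_L2_solution:
  assumes q: "loc_integrable q" and "is_sol q (complex_of_real l) u" "L2_left u" "u \<noteq> (\<lambda>_. 0)"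
  obtains v v' where "rsol q (\<lambda>x. l * v x) v v'" "L2_left v" "v 0 \<noteq> 0 \<or> v' 0 \<noteq> 0"
proof -
  obtain u' where u: "csol q (complex_of_real l) u u'"
    using assms(2) is_sol_iff_csol by blast
  have r: "rsol q (\<lambda>x. l * Re (u x)) (\<lambda>x. Re (u x)) (\<lambda>x. Re (u' x))"
    using csol_Re[OF q u] by simp
  have i: "rsol q (\<lambda>x. l * Im (u x)) (\<lambda>x. Im (u x)) (\<lambda>x. Im (u' x))"
    using csol_Im[OF q u] by simp
  have "L2_left (\<lambda>x. Re (u x))" "L2_left (\<lambda>x. Im (u x))"
    by (rule L2_left_continuousI[OF _ assms(3)];
        intro continuous_intros csol_continuous[OF u] abs_Re_le_cmod abs_Im_le_cmod)+
  moreover have "u 0 \<noteq> 0 \<or> u' 0 \<noteq> 0"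
    using csol_unique_0[OF q u] assms(4) by blast
  then have "(Re (u 0) \<noteq> 0 \<or> Re (u' 0) \<noteq> 0) \<or> (Im (u 0) \<noteq> 0 \<or> Im (u' 0) \<noteq> 0)"
    by (auto simp: complex_eq_iff)
  ultimately show ?thesis
    using that[OF r] that[OF i] by blast
qed

lemma jost_csol:
  assumes "jost q \<psi> k"
  obtains \<psi>' where "csol q (complex_of_real (k\<^sup>2)) (\<lambda>x. \<psi> x k) \<psi>'"
    "((\<lambda>x. \<psi> x k / cis (k * x)) \<longlongrightarrow> 1) at_top" "((\<lambda>x. \<psi>' x / cis (k * x)) \<longlongrightarrow> \<i> * complex_of_real k) at_top"
proof -
  obtain \<psi>' where \<psi>': "csol q (complex_of_real (k\<^sup>2)) (\<lambda>x. \<psi> x k) \<psi>'"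
    using assms by (auto simp: jost_def is_sol_iff_csol)
  then have "vector_derivative (\<lambda>t. \<psi> t k) (at x) = \<psi>' x" for x
    by (simp add: csol_def vector_derivative_at)
  then show ?thesis
    using that[OF \<psi>'] assms by (simp add: jost_def)
qed

text \<open>The Wronskian of Re u and Im u is Im (cnj u u'). It is constant, and since the phases
  cancel in the product, the asymptotics give the value Im (i k) at plus infinity.\<close>

lemma jost_wronskian:
  assumes q: "loc_integrable q" and \<psi>: "csol q (complex_of_real l) u u'"
    and lim: "((\<lambda>x. u x / cis (k * x)) \<longlongrightarrow> 1) at_top" "((\<lambda>x. u' x / cis (k * x)) \<longlongrightarrow> \<i> * complex_of_real k) at_top"
  shows "Re (u 0) * Im (u' 0) - Re (u' 0) * Im (u 0) = k"
proof -
  define W where "W x = Re (u x) * Im (u' x) - Re (u' x) * Im (u x)" for x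
  have r: "rsol q (\<lambda>x. l * Re (u x)) (\<lambda>x. Re (u x)) (\<lambda>x. Re (u' x))"
    using csol_Re[OF q \<psi>] by simp
  have i: "rsol q (\<lambda>x. l * Im (u x)) (\<lambda>x. Im (u x)) (\<lambda>x. Im (u' x))"
    using csol_Im[OF q \<psi>] by simp
  have "indef_int (\<lambda>x. 0) W"
    using wronskian_indef_int[OF r i] unfolding W_def[abs_def] by (simp add: mult.assoc mult.left_commute)
  then have "W b = W a" if "a \<le> b" for a b
    using that by (auto simp: indef_int_def)
  then have "\<forall>\<^sub>F x in at_top. W x = W 0"
    using eventually_ge_at_top[of "0::real"] by (rule eventually_mono[rotated])
  then have "(W \<longlongrightarrow> W 0) at_top"
    by (rule tendsto_eventually)
  moreover have "Im (cnj (u x / cis (k * x)) * (u' x / cis (k * x))) = W x" for x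
  proof -
    have "cnj (u x / cis (k * x)) * (u' x / cis (k * x)) = cnj (u x) * u' x / (cnj (cis (k * x)) * cis (k * x))"
      by simp
    also have "cnj (cis (k * x)) * cis (k * x) = 1"
      by (simp add: cis_cnj cis_mult)
    finally show ?thesis by (simp add: W_def)
  qed
  moreover have "((\<lambda>x. Im (cnj (u x / cis (k * x)) * (u' x / cis (k * x)))) \<longlongrightarrow> Im (cnj 1 * (\<i> * complex_of_real k))) at_top"
    by (intro tendsto_intros lim)
  ultimately have "(W \<longlongrightarrow> W 0) at_top" "(W \<longlongrightarrow> k) at_top"
    by simp_all
  then show ?thesis
    using tendsto_unique[of at_top W] by (simp add: W_def)
qed

text \<open>Two vectors of the plane that are parallel to the same nonzero vector (v, v') are
  parallel to each other.\<close>

lemma wronskian_proportional: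
  fixes v p s :: real
  assumes "v * p' = v' * p" "v * s' = v' * s" "v \<noteq> 0 \<or> v' \<noteq> 0"
  shows "p * s' = p' * s"
proof (cases "v = 0")
  case True
  with assms show ?thesis by auto
next
  case False
  with assms(1,2) have "p' = v' * p / v" "s' = v' * s / v" by (auto simp: field_simps)
  then show ?thesis by simp
qed

text \<open>The phase r and the derivative of the Jost solution are exported because the behaviour
  at plus infinity will be read off the Jost asymptotics.\<close>

theorem phiN_solution:
  assumes sb: "semibounded q" and q: "loc_integrable q" and "w > 0"
    and J: "jost q \<psi> w" and bv: "\<exists>\<phi>. left_weyl_bv q w \<phi>"
    and u: "is_sol q (complex_of_real (w\<^sup>2)) u" "L2_left u" "u \<noteq> (\<lambda>_. 0)"
  obtains r \<psi>' where "norm r = 1" "\<And>x. phiN q \<psi> w x = 2 * Re (r * \<psi> x w)"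
    "rsol q (\<lambda>x. w\<^sup>2 * phiN q \<psi> w x) (phiN q \<psi> w) (\<lambda>x. 2 * Re (r * \<psi>' x))"
    "L2_left (phiN q \<psi> w)"
    "((\<lambda>x. \<psi> x w / cis (w * x)) \<longlongrightarrow> 1) at_top" "((\<lambda>x. \<psi>' x / cis (w * x)) \<longlongrightarrow> \<i> * complex_of_real w) at_top"
proof -
  obtain \<psi>' where \<psi>': "csol q (complex_of_real (w\<^sup>2)) (\<lambda>x. \<psi> x w) \<psi>'"
    and lim: "((\<lambda>x. \<psi> x w / cis (w * x)) \<longlongrightarrow> 1) at_top" "((\<lambda>x. \<psi>' x / cis (w * x)) \<longlongrightarrow> \<i> * complex_of_real w) at_top"
    using jost_csol[OF J] by blast
  obtain v v' where v: "rsol q (\<lambda>x. w\<^sup>2 * v x) v v'" "L2_left v" "v 0 \<noteq> 0 \<or> v' 0 \<noteq> 0"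
    using real_L2_solution[OF q u] by blast
  define X where "X = complex_of_real (v 0) * \<psi>' 0 - complex_of_real (v' 0) * \<psi> 0 w"
  \<comment> \<open>Otherwise the data of Re psi and Im psi would both be parallel to those of v,
    although their Wronskian is w > 0.\<close>
  have "X \<noteq> 0"
  proof
    assume "X = 0"
    then have "v 0 * Re (\<psi>' 0) = v' 0 * Re (\<psi> 0 w)" "v 0 * Im (\<psi>' 0) = v' 0 * Im (\<psi> 0 w)"
      by (auto simp: X_def complex_eq_iff)
    from wronskian_proportional[OF this v(3)] jost_wronskian[OF q \<psi>' lim] \<open>w > 0\<close>
    show False by simp
  qed
  define \<phi> where "\<phi> = (SOME \<phi>. left_weyl_bv q w \<phi>)"
  have \<phi>: "left_weyl_bv q w \<phi>" unfolding \<phi>_def using bv by (rule someI_ex)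
  obtain \<phi>' where \<phi>': "csol q (complex_of_real (w\<^sup>2)) \<phi> \<phi>'"
    "\<phi> 0 * complex_of_real (v' 0) = \<phi>' 0 * complex_of_real (v 0)"
    using left_weyl_bv_wronskian[OF sb q \<open>w > 0\<close> \<phi> v(1,2)] by blast
  \<comment> \<open>The factor c depends on which boundary value \<open>SOME\<close> selects; it
    cancels in the quotient that defines \<open>refl\<close>.\<close>
  obtain c where c: "\<phi> 0 = c * complex_of_real (v 0)" "\<phi>' 0 = c * complex_of_real (v' 0)"
  proof (cases "v 0 = 0")
    case True
    then show ?thesis using that[of "\<phi>' 0 / complex_of_real (v' 0)"] \<phi>'(2) v(3) by (auto simp: field_simps)
  next
    case False
    then show ?thesis using that[of "\<phi> 0 / complex_of_real (v 0)"] \<phi>'(2) v(3) by (auto simp: field_simps)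
  qed
  have "c \<noteq> 0"
  proof
    assume "c = 0"
    then have "\<phi> x = 0" for x using csol_unique_0[OF q \<phi>'(1)] c by simp
    then show False using \<phi> by (auto simp: left_weyl_bv_def fun_eq_iff)
  qed
  have d: "vector_derivative \<phi> (at 0) = \<phi>' 0" "vector_derivative (\<lambda>x. \<psi> x w) (at 0) = \<psi>' 0"
    using \<phi>'(1) \<psi>' by (auto simp: csol_def vector_derivative_at)
  have "((\<lambda>x. cnj (\<psi> x w)) has_vector_derivative cnj (\<psi>' 0)) (at 0)"
    using \<psi>' bounded_linear.has_vector_derivative[OF bounded_linear_cnj] unfolding csol_def by blast
  then have d3: "vector_derivative (\<lambda>x. cnj (\<psi> x w)) (at 0) = cnj (\<psi>' 0)"
    by (rule vector_derivative_at)
  have "refl q \<psi> w = - wronsk \<phi> (\<lambda>x. cnj (\<psi> x w)) / wronsk \<phi> (\<lambda>x. \<psi> x w)"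
    using bv unfolding refl_def \<phi>_def Let_def by simp
  also have "wronsk \<phi> (\<lambda>x. cnj (\<psi> x w)) = c * cnj X"
    by (simp add: wronsk_def d d3 c X_def algebra_simps)
  also have "wronsk \<phi> (\<lambda>x. \<psi> x w) = c * X"
    by (simp add: wronsk_def d c X_def algebra_simps)
  also have "- (c * cnj X) / (c * X) = - cnj X / X"
    using \<open>c \<noteq> 0\<close> by simp
  finally have R: "refl q \<psi> w = - cnj X / X" .
  define r where "r = csqrt (refl q \<psi> w)"
  have r2: "r\<^sup>2 = - cnj X / X" by (simp add: r_def R)
  have "(norm r)\<^sup>2 = 1"
    unfolding norm_power[symmetric] r2 using \<open>X \<noteq> 0\<close> by (simp add: norm_divide)
  then have nr: "norm r = 1"
    by (simp add: power2_eq_1_iff) (use norm_ge_zero[of r] in linarith)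
  then have rr: "cnj r * r = 1" using complex_norm_square[of r] by (simp add: mult.commute)
  \<comment> \<open>r X equals minus its conjugate, so its real part vanishes. As v is real, that
    real part is half the Wronskian of v and \<open>phiN\<close>, which are therefore
    proportional.\<close>
  have "r * X = cnj r * r * r * X" using rr by simp
  also have "\<dots> = cnj r * (r\<^sup>2 * X)" by (simp add: power2_eq_square)
  also have "\<dots> = - cnj (r * X)" unfolding r2 using \<open>X \<noteq> 0\<close> by simp
  finally have "r * X = - cnj (r * X)" .
  moreover have "Re z = 0" if "z = - cnj z" for z
    using that by (simp add: complex_eq_iff)
  ultimately have RX: "Re (r * X) = 0" by blast
  have phi: "phiN q \<psi> w x = 2 * Re (r * \<psi> x w)" for x by (simp add: phiN_def r_def)
  have P: "rsol q (\<lambda>x. w\<^sup>2 * phiN q \<psi> w x) (phiN q \<psi> w) (\<lambda>x. 2 * Re (r * \<psi>' x))"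
    using csol_Re[OF q csol_cmult[OF \<psi>', where c="2 * r"]] unfolding phi[abs_def] by (simp add: mult.assoc)
  have "v 0 * (2 * Re (r * \<psi>' 0)) = v' 0 * phiN q \<psi> w 0"
    using RX unfolding phi X_def by (simp add: algebra_simps)
  from rsol_proportional[OF q v(1) P this v(3)] obtain a where "phiN q \<psi> w = (\<lambda>x. a * v x)" by blast
  then have "L2_left (phiN q \<psi> w)" using L2_left_cmult[OF v(2)] by simp
  then show ?thesis using that nr phi P lim by blast
qed

text \<open>Far to the right f is 2 cos (w x + t) up to an error e with |e| <= 1/2, where t is the
  argument of r. Hence f^2 >= 1 + cos (2 w x + 2 t) - 1/4: the mean is at least 3/4, and the
  oscillating part changes the integral by at most 1/w.\<close>

lemma jost_oscillation:
  fixes u u' :: "real \<Rightarrow> complex" and f :: "real \<Rightarrow> real"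
  assumes lim: "((\<lambda>x. u x / cis (w * x)) \<longlongrightarrow> 1) at_top" "((\<lambda>x. u' x / cis (w * x)) \<longlongrightarrow> \<i> * complex_of_real w) at_top"
    and "w > 0" and r: "norm r = 1" and f: "\<And>x. f x = 2 * Re (r * u x)" "\<And>x. f' x = 2 * Re (r * u' x)"
    and cf: "continuous_on UNIV f"
  obtains X where "\<And>x. x \<ge> X \<Longrightarrow> \<bar>f x\<bar> \<le> 4" "\<And>x. x \<ge> X \<Longrightarrow> \<bar>f' x\<bar> \<le> 2 * (w + 1)"
    "\<And>x. x \<ge> X \<Longrightarrow> integral {X..x} (\<lambda>s. f s * f s) \<ge> 3/4 * (x - X) - 1/w"
proof -
  have "\<forall>\<^sub>F x in at_top. dist (u x / cis (w * x)) 1 < 1/4" "\<forall>\<^sub>F x in at_top. dist (u' x / cis (w * x)) (\<i> * complex_of_real w) < 1"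
    by (rule tendstoD[OF lim(1)], simp, rule tendstoD[OF lim(2)], simp)
  then have "\<forall>\<^sub>F x in at_top. dist (u x / cis (w * x)) 1 < 1/4 \<and> dist (u' x / cis (w * x)) (\<i> * complex_of_real w) < 1"
    by (rule eventually_conj)
  then obtain X where X: "\<And>x. x \<ge> X \<Longrightarrow> dist (u x / cis (w * x)) 1 < 1/4"
    "\<And>x. x \<ge> X \<Longrightarrow> dist (u' x / cis (w * x)) (\<i> * complex_of_real w) < 1"
    by (auto simp: eventually_at_top_linorder)
  have near: "norm (u x - cis (w * x)) \<le> 1/4" if "x \<ge> X" for x
  proof -
    have "u x - cis (w * x) = (u x / cis (w * x) - 1) * cis (w * x)"
      by (simp add: field_simps)
    then have "norm (u x - cis (w * x)) = norm (u x / cis (w * x) - 1)"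
      by (simp add: norm_mult)
    then show ?thesis using X(1)[OF that] by (simp add: dist_norm)
  qed
  have Re_r: "\<bar>Re (r * z)\<bar> \<le> norm z" for z
    using abs_Re_le_cmod[of "r * z"] r by (simp add: norm_mult)
  have f_le: "\<bar>f x\<bar> \<le> 4" if "x \<ge> X" for x
    using near[OF that] norm_triangle_ineq[of "u x - cis (w * x)" "cis (w * x)"] Re_r[of "u x"]
    by (simp add: f abs_mult)
  have f'_le: "\<bar>f' x\<bar> \<le> 2 * (w + 1)" if "x \<ge> X" for x
  proof -
    have "norm (u' x) = norm (u' x / cis (w * x))" by (simp add: norm_divide)
    also have "\<dots> \<le> w + 1"
      using X(2)[OF that] norm_triangle_ineq[of "u' x / cis (w * x) - \<i> * complex_of_real w" "\<i> * complex_of_real w"] \<open>w > 0\<close>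
      by (simp add: dist_norm norm_mult)
    finally show ?thesis using Re_r[of "u' x"] by (simp add: f abs_mult)
  qed
  define t where "t = Arg r"
  have rc: "r = cis t"
    using r rcis_cmod_Arg[of r] by (simp add: t_def rcis_def)
  have low: "3/4 + cos (2 * w * x + 2 * t) \<le> f x * f x" if "x \<ge> X" for x
  proof -
    define a where "a = 2 * cos (w * x + t)"
    define e where "e = 2 * Re (r * (u x - cis (w * x)))"
    have "r * cis (w * x) = cis (w * x + t)" by (simp add: rc cis_mult add.commute)
    then have "Re (r * cis (w * x)) = cos (w * x + t)" by simp
    then have fx: "f x = a + e" by (simp add: f a_def e_def right_diff_distrib)
    have "\<bar>e\<bar> \<le> 1/2" using Re_r[of "u x - cis (w * x)"] near[OF that] unfolding e_def abs_mult by simp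
    then have "e\<^sup>2 \<le> (1/2)\<^sup>2" using abs_le_square_iff[of e "1/2"] by simp
    \<comment> \<open>Half of this square is (a + e)^2 - a^2 / 2 + e^2.\<close>
    moreover have "0 \<le> (a + 2 * e)\<^sup>2" by simp
    then have "a\<^sup>2 / 2 - e\<^sup>2 \<le> (a + e) * (a + e)"
      by (simp add: power2_eq_square algebra_simps)
    moreover have "a\<^sup>2 / 2 = 1 + cos (2 * (w * x + t))"
      unfolding a_def cos_double_cos by (simp add: power2_eq_square)
    ultimately show ?thesis
      by (simp add: fx power2_eq_square algebra_simps)
  qed
  have "3/4 * (x - X) - 1/w \<le> integral {X..x} (\<lambda>s. f s * f s)" if "x \<ge> X" for x
  proof -
    let ?Q = "\<lambda>s. 3/4 * s + sin (2 * w * s + 2 * t) / (2 * w)"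
    have hi: "((\<lambda>s. 3/4 + cos (2 * w * s + 2 * t)) has_integral ?Q x - ?Q X) {X..x}"
    proof (rule fundamental_theorem_of_calculus[OF that])
      fix s
      have "(?Q has_real_derivative 3/4 + cos (2 * w * s + 2 * t)) (at s)"
        using \<open>w > 0\<close> by (auto intro!: derivative_eq_intros)
      then show "(?Q has_vector_derivative 3/4 + cos (2 * w * s + 2 * t)) (at s within {X..x})"
        by (auto simp: has_real_derivative_iff_has_vector_derivative intro: has_vector_derivative_at_within)
    qed
    have "\<bar>sin (2 * w * s + 2 * t) / (2 * w)\<bar> \<le> 1 / (2 * w)" for s
      using \<open>w > 0\<close> by (simp add: abs_divide divide_right_mono)
    from this[of x] this[of X] have "- (1 / (2 * w)) \<le> sin (2 * w * x + 2 * t) / (2 * w)"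
      "sin (2 * w * X + 2 * t) / (2 * w) \<le> 1 / (2 * w)"
      unfolding abs_le_iff by linarith+
    moreover have "1 / w = 1 / (2 * w) + 1 / (2 * w)" by simp
    ultimately have "3/4 * (x - X) - 1/w \<le> ?Q x - ?Q X"
      unfolding right_diff_distrib by linarith
    also have "\<dots> \<le> integral {X..x} (\<lambda>s. f s * f s)"
      by (rule has_integral_le[OF hi integrable_integral])
         (auto intro!: integrable_continuous_real continuous_intros continuous_on_subset[OF cf] low)
    finally show ?thesis .
  qed
  then show ?thesis using that f_le f'_le by blast
qed

section \<open>The double commutation\<close>

text \<open>The product rule in the Leibniz formula, regrouped by the row that is
  differentiated.\<close>

lemma DERIV_det:
  fixes M :: "real \<Rightarrow> real^'n^'n"
  assumes M: "\<And>i j. ((\<lambda>t. M t $ i $ j) has_real_derivative M' $ i $ j) (at x)"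
  shows "((\<lambda>t. det (M t)) has_real_derivative
      (\<Sum>k\<in>UNIV. det (\<chi> i. if i = k then M' $ i else M x $ i))) (at x)"
proof -
  let ?P = "{p. p permutes (UNIV :: 'n set)}"
  have "((\<lambda>t. det (M t)) has_real_derivative
      (\<Sum>p\<in>?P. of_int (sign p) * (\<Sum>k\<in>UNIV. M' $ k $ p k * (\<Prod>i\<in>UNIV-{k}. M x $ i $ p i)))) (at x)"
    unfolding det_def by (intro DERIV_sum DERIV_cmult has_field_derivative_prod M)
  moreover have "M' $ k $ p k * (\<Prod>i\<in>UNIV-{k}. M x $ i $ p i) =
      (\<Prod>i\<in>UNIV. (\<chi> i. if i = k then M' $ i else M x $ i) $ i $ p i)" for k p
    by (subst prod.remove[of UNIV k]) (auto intro!: prod.cong)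
  ultimately show ?thesis
    unfolding det_def sum_distrib_left by (subst sum.swap) simp
qed

text \<open>Along the segment from I to I + G the form v . (I + t G) v is at least |v|^2, so the
  determinant never vanishes; it starts at 1 and keeps its sign by the intermediate value
  theorem.\<close>

lemma det_pos_if_positive_definite:
  fixes G :: "real^'n^'n"
  assumes "\<And>v. 0 \<le> v \<bullet> (G *v v)"
  shows "det (mat 1 + G) > 0"
proof (rule ccontr)
  assume neg: "\<not> det (mat 1 + G) > 0"
  let ?f = "\<lambda>t. det (mat 1 + t *\<^sub>R G)"
  have nz: "?f t \<noteq> 0" if "t \<ge> 0" for t
  proof -
    have "v = 0" if v: "(mat 1 + t *\<^sub>R G) *v v = 0" for v
    proof -
      have "0 = v \<bullet> ((mat 1 + t *\<^sub>R G) *v v)" using v by simp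
      also have "\<dots> = v \<bullet> v + t * (v \<bullet> (G *v v))"
        by (simp add: matrix_vector_mult_add_rdistrib inner_add_right scaleR_matrix_vector_assoc[symmetric])
      finally have "v \<bullet> v = 0"
        using assms[of v] \<open>t \<ge> 0\<close> mult_nonneg_nonneg[of t "v \<bullet> (G *v v)"] inner_ge_zero[of v] by linarith
      then show ?thesis by simp
    qed
    then have "invertible (mat 1 + t *\<^sub>R G)"
      unfolding invertible_left_inverse matrix_left_invertible_ker by blast
    then show ?thesis by (simp add: invertible_det_nz)
  qed
  have "continuous_on {0..1} ?f"
    unfolding det_def by (intro continuous_intros)
  then have "\<exists>t. 0 \<le> t \<and> t \<le> 1 \<and> ?f t = 0"
    by (intro IVT2') (use neg in auto)
  then show False using nz by blast
qed

lemma sum_delta_mult: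
  fixes f :: "'n::finite \<Rightarrow> real"
  shows "(\<Sum>r\<in>UNIV. (if i = r then 1 else 0) * f r) = f i" "(\<Sum>r\<in>UNIV. f r * (if r = i then 1 else 0)) = f i"
  by (subst sum.remove[of UNIV i]; auto intro!: sum.neutral)+

text \<open>Separates the algebra of the transform from its spectral input: semiboundedness is felt
  here only through \<open>wronskian\<close>, which is the commutator identity for diag(l) and the
  Gram matrix.\<close>

locale double_commutation =
  fixes q :: "real \<Rightarrow> real" and l :: "'n::finite \<Rightarrow> real" and a a' :: "'n \<Rightarrow> real \<Rightarrow> real"
  assumes sol: "rsol q (\<lambda>x. l n * a n x) (a n) (a' n)"
    and L2: "L2_left (a n)"
    and wronskian: "a m x * a' n x - a' m x * a n x = (l m - l n) * integral {..x} (\<lambda>s. a m s * a n s)"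
begin

definition g :: "'n \<Rightarrow> 'n \<Rightarrow> real \<Rightarrow> real" where
  "g m n x = integral {..x} (\<lambda>s. a m s * a n s)"

definition G :: "real \<Rightarrow> real^'n^'n" where
  "G x = (\<chi> m n. g m n x)"

definition K :: "real \<Rightarrow> real^'n^'n" where
  "K x = matrix_inv (mat 1 + G x)"

definition k :: "'n \<Rightarrow> 'n \<Rightarrow> real \<Rightarrow> real" where
  "k m n x = K x $ m $ n"

definition y :: "'n \<Rightarrow> real \<Rightarrow> real" where
  "y n x = - (\<Sum>j\<in>UNIV. k n j x * a j x)"

text \<open>The trace of K G' is a . K a = - y . a, so - s is the logarithmic derivative of det (I +
  G).\<close>

definition s :: "real \<Rightarrow> real" where
  "s x = (\<Sum>j\<in>UNIV. y j x * a j x)"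

text \<open>What y = - K a and K' = - y y^T give by the product rule.\<close>

definition y' :: "'n \<Rightarrow> real \<Rightarrow> real" where
  "y' n x = s x * y n x - (\<Sum>j\<in>UNIV. k n j x * a' j x)"

text \<open>Differentiating y . a leaves s^2 - (K a') . a + y . a'; by symmetry of K the last two
  terms are equal.\<close>

definition s' :: "real \<Rightarrow> real" where
  "s' x = (s x)\<^sup>2 + 2 * (\<Sum>j\<in>UNIV. y j x * a' j x)"

section \<open>The Gram matrix and its inverse\<close>

lemma a_continuous: "continuous_on S (a n)" "continuous_on S (a' n)"
  using rsol_continuous[OF sol] continuous_on_subset by blast+

lemma a_DERIV: "(a n has_real_derivative a' n x) (at x)"
  using sol by (simp add: rsol_def)

lemma aa_integrable: "(\<lambda>s. a m s * a n s) integrable_on {..x}"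
  by (intro integral_left_tail(1) L2_left_mult_set_integrable L2)

lemma g_sym: "g m n = g n m"
  by (simp add: g_def fun_eq_iff mult.commute)

text \<open>The form is the integral of the square of the combination of the \<open>a n\<close> with
  coefficients v.\<close>

lemma G_psd: "0 \<le> v \<bullet> (G x *v v)"
proof -
  have i: "(\<lambda>s. v$m * (a m s * a n s * v$n)) integrable_on {..x}" for m n
    by (intro integrable_on_mult_left integrable_on_mult_right aa_integrable)
  have "v \<bullet> (G x *v v) = (\<Sum>m\<in>UNIV. \<Sum>n\<in>UNIV. integral {..x} (\<lambda>s. v$m * (a m s * a n s * v$n)))"
    by (simp add: inner_vec_def matrix_vector_mult_def G_def g_def sum_distrib_left)
  also have "\<dots> = integral {..x} (\<lambda>s. \<Sum>m\<in>UNIV. \<Sum>n\<in>UNIV. v$m * (a m s * a n s * v$n))"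
    by (subst integral_sum, simp, intro integrable_sum i, simp)
       (subst integral_sum, simp, intro i, simp)
  also have "\<dots> = integral {..x} (\<lambda>s. (\<Sum>m\<in>UNIV. v$m * a m s)\<^sup>2)"
    by (simp add: power2_eq_square sum_product algebra_simps)
  also have "\<dots> \<ge> 0"
  proof (rule Henstock_Kurzweil_Integration.integral_nonneg)
    have "(\<lambda>s. \<Sum>m\<in>UNIV. \<Sum>n\<in>UNIV. v$m * (a m s * a n s * v$n)) integrable_on {..x}"
      by (intro integrable_sum i finite)
    then show "(\<lambda>s. (\<Sum>m\<in>UNIV. v$m * a m s)\<^sup>2) integrable_on {..x}"
      by (simp add: power2_eq_square sum_product algebra_simps)
  qed simp
  finally show ?thesis .
qed

lemma det_pos: "det (mat 1 + G x) > 0"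
  by (rule det_pos_if_positive_definite[OF G_psd])

lemma K_inverse: "(mat 1 + G x) ** K x = mat 1" "K x ** (mat 1 + G x) = mat 1"
proof -
  have "invertible (mat 1 + G x)"
    using det_pos[of x] by (simp add: invertible_det_nz)
  then have "\<exists>B. (mat 1 + G x) ** B = mat 1 \<and> B ** (mat 1 + G x) = mat 1"
    by (simp add: invertible_def)
  from someI_ex[OF this] show "(mat 1 + G x) ** K x = mat 1" "K x ** (mat 1 + G x) = mat 1"
    by (simp_all add: K_def matrix_inv_def)
qed

lemma IG_transpose: "transpose (mat 1 + G x) = mat 1 + G x"
  by (auto simp: transpose_def G_def mat_def vec_eq_iff g_sym)

lemma k_sym: "k m n x = k n m x"
proof -
  have "transpose (K x) ** (mat 1 + G x) = mat 1"
    using arg_cong[OF K_inverse(1), of transpose, of x]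
    by (simp add: matrix_transpose_mul IG_transpose transpose_mat)
  then have "transpose (K x) ** ((mat 1 + G x) ** K x) = K x"
    unfolding matrix_mul_assoc by simp
  then have "transpose (K x) $ n $ m = K x $ n $ m"
    by (simp add: K_inverse)
  then show ?thesis
    by (simp add: k_def transpose_def)
qed

lemma k_g:
  "(\<Sum>p\<in>UNIV. k i p x * g p j x) = (if i = j then 1 else 0) - k i j x"
  "(\<Sum>p\<in>UNIV. g i p x * k p j x) = (if i = j then 1 else 0) - k i j x"
proof -
  have "K x ** G x = mat 1 - K x"
    using K_inverse(2)[of x] by (simp add: matrix_add_ldistrib algebra_simps)
  then have "(K x ** G x) $ i $ j = (mat 1 - K x) $ i $ j" for i j by simp
  then have *: "(\<Sum>p\<in>UNIV. k i p x * g p j x) = (if i = j then 1 else 0) - k i j x" for i j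
    by (simp add: matrix_matrix_mult_def mat_def k_def G_def)
  show "(\<Sum>p\<in>UNIV. k i p x * g p j x) = (if i = j then 1 else 0) - k i j x"
    by (rule *)
  have "(\<Sum>p\<in>UNIV. g i p x * k p j x) = (\<Sum>p\<in>UNIV. k j p x * g p i x)"
    by (intro sum.cong refl) (simp add: g_sym[of i] k_sym[of j])
  then show "(\<Sum>p\<in>UNIV. g i p x * k p j x) = (if i = j then 1 else 0) - k i j x"
    unfolding * using k_sym[of i j x] by auto
qed

text \<open>If (I + G) v is the j-th unit vector, then |v|^2 <= v . (I + G) v = v_j <= |v|. The
  bound is uniform in x, and the continuity of K and both of its limits at infinity rest on
  it.\<close>

lemma k_bound: "\<bar>k i j x\<bar> \<le> 1"
proof -
  define v where "v = K x *v axis j 1"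
  have v: "(mat 1 + G x) *v v = axis j 1"
    unfolding v_def by (simp add: matrix_vector_mul_assoc K_inverse)
  have "norm v * norm v = v \<bullet> v" by (simp add: dot_square_norm power2_eq_square)
  also have "\<dots> \<le> v \<bullet> v + v \<bullet> (G x *v v)" using G_psd by simp
  also have "\<dots> = v \<bullet> axis j 1"
    unfolding v[symmetric] by (simp add: matrix_vector_mult_add_rdistrib inner_add_right)
  also have "\<dots> \<le> norm v * 1"
    using norm_cauchy_schwarz[of v "axis j 1"] by simp
  finally have "norm v \<le> 1"
    by (metis mult_left_le_imp_le norm_zero norm_ge_zero order_le_less zero_le_one)
  moreover have "v $ i = k i j x"
    by (simp add: v_def k_def matrix_vector_mul_component inner_axis)
  ultimately show ?thesis
    using component_le_norm_cart[of v i] by simp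
qed

section \<open>Derivatives of the Gram matrix, its inverse and the transform\<close>

lemma g_DERIV: "(g m n has_real_derivative a m x * a n x) (at x)"
proof -
  let ?w = "\<lambda>s. a m s * a n s"
  let ?S = "{x-1<..<x+1}"
  have si: "set_integrable lborel {..t} ?w" for t
    by (intro L2_left_mult_set_integrable L2)
  have "((\<lambda>u. integral {x-1..u} ?w) has_vector_derivative ?w x) (at x within {x-1..x+1})"
    by (rule integral_has_vector_derivative) (auto intro!: continuous_intros a_continuous)
  then have "((\<lambda>u. integral {x-1..u} ?w) has_vector_derivative ?w x) (at x within ?S)"
    by (rule has_vector_derivative_within_subset) auto
  then have "((\<lambda>u. integral {x-1..u} ?w) has_vector_derivative ?w x) (at x)"
    by (simp add: at_within_open[of x ?S])
  then have "((\<lambda>u. g m n (x-1) + integral {x-1..u} ?w) has_vector_derivative 0 + ?w x) (at x)"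
    by (intro derivative_intros)
  then have 1: "((\<lambda>u. g m n (x-1) + integral {x-1..u} ?w) has_vector_derivative ?w x) (at x)"
    by simp
  have 2: "g m n (x-1) + integral {x-1..u} ?w = g m n u" if "u \<in> ?S" for u
    using that integral_left_tail(3)[of ?w "x-1" u, OF si] by (simp add: g_def)
  have "(g m n has_vector_derivative ?w x) (at x)"
    by (rule has_vector_derivative_transform_within_open[where S="?S", OF 1 _ _ 2]) auto
  then show ?thesis by (simp add: has_real_derivative_iff_has_vector_derivative)
qed

text \<open>The second resolvent identity. Since K occurs at both points, it yields continuity first
  (with \<open>k_bound\<close>) and, after division by z - x, the derivative - K G' K.\<close>

lemma k_difference:
  "k i j z - k i j x = - (\<Sum>p\<in>UNIV. \<Sum>r\<in>UNIV. k i p z * (g p r z - g p r x) * k r j x)"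
proof -
  have "(\<Sum>p\<in>UNIV. \<Sum>r\<in>UNIV. k i p z * (g p r z - g p r x) * k r j x)
    = (\<Sum>p\<in>UNIV. \<Sum>r\<in>UNIV. k i p z * g p r z * k r j x) - (\<Sum>p\<in>UNIV. \<Sum>r\<in>UNIV. k i p z * g p r x * k r j x)"
    unfolding sum_subtractf[symmetric] by (intro sum.cong refl) (simp add: algebra_simps)
  also have "(\<Sum>p\<in>UNIV. \<Sum>r\<in>UNIV. k i p z * g p r z * k r j x) = (\<Sum>r\<in>UNIV. (\<Sum>p\<in>UNIV. k i p z * g p r z) * k r j x)"
    unfolding sum_distrib_right by (rule sum.swap)
  also have "\<dots> = k i j x - (\<Sum>r\<in>UNIV. k i r z * k r j x)"
    unfolding k_g left_diff_distrib sum_subtractf sum_delta_mult ..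
  also have "(\<Sum>p\<in>UNIV. \<Sum>r\<in>UNIV. k i p z * g p r x * k r j x) = (\<Sum>p\<in>UNIV. k i p z * (\<Sum>r\<in>UNIV. g p r x * k r j x))"
    unfolding sum_distrib_left mult.assoc ..
  also have "\<dots> = k i j z - (\<Sum>r\<in>UNIV. k i r z * k r j x)"
    unfolding k_g right_diff_distrib sum_subtractf sum_delta_mult ..
  finally show ?thesis by simp
qed

lemma tendsto_bounded_mult_0:
  fixes f :: "real \<Rightarrow> real"
  assumes "(f \<longlongrightarrow> 0) F" "\<And>z. \<bar>h z\<bar> \<le> B"
  shows "((\<lambda>z. h z * f z) \<longlongrightarrow> 0) F"
proof (rule Lim_null_comparison)
  have "B \<ge> 0" using assms(2)[of undefined] by linarith
  then show "\<forall>\<^sub>F z in F. norm (h z * f z) \<le> B * \<bar>f z\<bar>"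
    using assms(2) by (intro always_eventually allI) (auto simp: abs_mult intro: mult_right_mono)
  show "((\<lambda>z. B * \<bar>f z\<bar>) \<longlongrightarrow> 0) F"
    using assms(1) by (intro tendsto_mult_right_zero tendsto_rabs_zero)
qed

lemma k_isCont: "isCont (k i j) x"
proof -
  have "((\<lambda>z. g p r z - g p r x) \<longlongrightarrow> 0) (at x)" for p r
    using DERIV_isCont[OF g_DERIV] LIM_zero unfolding isCont_def by blast
  then have "((\<lambda>z. k i p z * (g p r z - g p r x)) \<longlongrightarrow> 0) (at x)" for p r
    by (rule tendsto_bounded_mult_0[where B=1, OF _ k_bound])
  then have "((\<lambda>z. - (\<Sum>p\<in>UNIV. \<Sum>r\<in>UNIV. k i p z * (g p r z - g p r x) * k r j x))
      \<longlongrightarrow> - (\<Sum>p\<in>(UNIV::'n set). \<Sum>r\<in>(UNIV::'n set). 0 * k r j x)) (at x)"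
    by (intro tendsto_intros)
  then have "((\<lambda>z. k i j z - k i j x) \<longlongrightarrow> 0) (at x)"
    unfolding k_difference by simp
  then show ?thesis unfolding isCont_def by (rule LIM_zero_cancel)
qed

lemma k_DERIV: "(k i j has_real_derivative - (y i x * y j x)) (at x)"
proof -
  have "((\<lambda>z. - (\<Sum>p\<in>UNIV. \<Sum>r\<in>UNIV. k i p z * ((g p r z - g p r x) / (z - x)) * k r j x))
     \<longlongrightarrow> - (\<Sum>p\<in>UNIV. \<Sum>r\<in>UNIV. k i p x * (a p x * a r x) * k r j x)) (at x)"
    using g_DERIV k_isCont unfolding has_field_derivative_iff isCont_def by (intro tendsto_intros)
  moreover have "- (\<Sum>p\<in>UNIV. \<Sum>r\<in>UNIV. k i p z * ((g p r z - g p r x) / (z - x)) * k r j x)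
      = (k i j z - k i j x) / (z - x)" for z
    unfolding k_difference by (simp add: sum_divide_distrib)
  moreover have "(\<Sum>p\<in>UNIV. \<Sum>r\<in>UNIV. k i p x * (a p x * a r x) * k r j x) = y i x * y j x"
    unfolding y_def minus_mult_minus sum_product
  proof (intro sum.cong refl)
    fix p r
    show "k i p x * (a p x * a r x) * k r j x = k i p x * a p x * (k j r x * a r x)"
      using k_sym[of r j x] by simp
  qed
  ultimately show ?thesis
    unfolding has_field_derivative_iff by simp
qed

lemma y_DERIV: "(y n has_real_derivative y' n x) (at x)"
proof -
  have "((\<lambda>x. - (\<Sum>j\<in>UNIV. k n j x * a j x)) has_real_derivative
      - (\<Sum>j\<in>UNIV. - (y n x * y j x) * a j x + a' j x * k n j x)) (at x)"
    by (intro DERIV_minus DERIV_sum DERIV_mult k_DERIV a_DERIV)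
  moreover have "- (\<Sum>j\<in>UNIV. - (y n x * y j x) * a j x + a' j x * k n j x) = y' n x"
  proof -
    have "(\<Sum>j\<in>UNIV. - (y n x * y j x) * a j x) = - (s x * y n x)"
      unfolding s_def sum_distrib_right sum_negf[symmetric] by (intro sum.cong) simp_all
    then show ?thesis
      unfolding y'_def sum.distrib by (simp add: mult.commute)
  qed
  ultimately show ?thesis by (simp add: y_def[abs_def])
qed

lemma s_DERIV: "(s has_real_derivative s' x) (at x)"
proof -
  have "((\<lambda>x. \<Sum>j\<in>UNIV. y j x * a j x) has_real_derivative (\<Sum>j\<in>UNIV. y' j x * a j x + a' j x * y j x)) (at x)"
    by (intro DERIV_sum DERIV_mult y_DERIV a_DERIV)
  moreover have "(\<Sum>j\<in>UNIV. y' j x * a j x + a' j x * y j x) = s' x"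
  proof -
    have "(\<Sum>j\<in>UNIV. (\<Sum>i\<in>UNIV. k j i x * a' i x) * a j x) = (\<Sum>i\<in>UNIV. \<Sum>j\<in>UNIV. k i j x * a j x * a' i x)"
      unfolding sum_distrib_right by (subst sum.swap) (simp add: k_sym mult.commute mult.left_commute)
    also have "\<dots> = - (\<Sum>i\<in>UNIV. y i x * a' i x)"
      by (simp add: y_def sum_distrib_right sum_negf)
    finally have 1: "(\<Sum>j\<in>UNIV. (\<Sum>i\<in>UNIV. k j i x * a' i x) * a j x) = - (\<Sum>i\<in>UNIV. y i x * a' i x)" .
    have 2: "(\<Sum>j\<in>UNIV. s x * y j x * a j x) = (s x)\<^sup>2"
      by (simp add: s_def power2_eq_square sum_distrib_left mult.assoc)
    show ?thesis
      unfolding y'_def left_diff_distrib sum.distrib sum_subtractf 1 2 s'_def by (simp add: mult.commute)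
  qed
  ultimately show ?thesis by (simp add: s_def[abs_def])
qed

lemma K_vec: "K x *v (\<chi> n. a n x) = - (\<chi> n. y n x)"
  by (simp add: vec_eq_iff matrix_vector_mult_def y_def k_def)

text \<open>Differentiating row k replaces it by a_k times the vector a. As (I + G)(- y) = a,
  Cramer's rule evaluates the resulting determinant to - a_k y_k det (I + G). Cramer's rule replaces
  columns, hence the transposition, which is harmless for a symmetric matrix.\<close>

lemma ln_det_DERIV: "((\<lambda>t. ln (det (mat 1 + G t))) has_real_derivative - s x) (at x)"
proof -
  let ?A = "mat 1 + G x" and ?v = "\<chi> n. a n x"
  have "((\<lambda>t. (mat 1 + G t) $ i $ j) has_real_derivative (\<chi> i j. a i x * a j x) $ i $ j) (at x)" for i j
    using g_DERIV[of i j x] by (auto simp: G_def intro!: derivative_eq_intros)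
  from DERIV_det[OF this] have
    "((\<lambda>t. det (mat 1 + G t)) has_real_derivative
      (\<Sum>k\<in>UNIV. det (\<chi> i. if i = k then (\<chi> i j. a i x * a j x) $ i else ?A $ i))) (at x)" .
  moreover have "det (\<chi> i. if i = k then (\<chi> i j. a i x * a j x) $ i else ?A $ i) = - a k x * y k x * det ?A" for k
  proof -
    have "(\<chi> i. if i = k then (\<chi> i j. a i x * a j x) $ i else ?A $ i) = (\<chi> i. if i = k then a k x *s ?v else ?A $ i)"
      by (simp add: vec_eq_iff)
    then have "det (\<chi> i. if i = k then (\<chi> i j. a i x * a j x) $ i else ?A $ i)
      = a k x * det (\<chi> i. if i = k then ?v else ?A $ i)"
      by (simp only: det_row_mul)
    also have "det (\<chi> i. if i = k then ?v else ?A $ i) = det (transpose (\<chi> i. if i = k then ?v else ?A $ i))"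
      by (simp add: det_transpose)
    also have "?A *v (- (\<chi> n. y n x)) = ?v"
      unfolding K_vec[symmetric] by (simp add: matrix_vector_mul_assoc K_inverse)
    then have "transpose (\<chi> i. if i = k then ?v else ?A $ i) = (\<chi> i j. if j = k then (?A *v (- (\<chi> n. y n x))) $ i else ?A $ i $ j)"
      by (auto simp: vec_eq_iff transpose_def G_def mat_def g_sym)
    then have "det (transpose (\<chi> i. if i = k then ?v else ?A $ i)) = - y k x * det ?A"
      by (simp only: cramer_lemma) simp
    finally show ?thesis by simp
  qed
  moreover have "(\<Sum>k\<in>UNIV. - a k x * y k x * det ?A) = - s x * det ?A"
    unfolding s_def sum_negf[symmetric] sum_distrib_right by (intro sum.cong) simp_all
  ultimately have "((\<lambda>t. det (mat 1 + G t)) has_real_derivative - s x * det ?A) (at x)"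
    by (simp only:)
  from DERIV_chain'[OF this DERIV_ln_divide[OF det_pos]] show ?thesis
    using det_pos[of x] by simp
qed

lemma second_log_derivative: "deriv (deriv (\<lambda>t. ln (det (mat 1 + G t)))) x = - s' x"
proof -
  have "deriv (\<lambda>t. ln (det (mat 1 + G t))) = (\<lambda>t. - s t)"
    using DERIV_imp_deriv[OF ln_det_DERIV] by (simp add: fun_eq_iff)
  then show ?thesis
    using DERIV_imp_deriv[OF DERIV_minus[OF s_DERIV]] by simp
qed

lemma y_continuous: "continuous_on S (y n)" "continuous_on S (k i j)" "continuous_on S s"
    "continuous_on S (y' n)" "continuous_on S s'"
proof -
  show 1: "continuous_on S (y n)" for S n
    using y_DERIV DERIV_isCont by (blast intro: continuous_at_imp_continuous_on)
  show 2: "continuous_on S (k i j)" for S i j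
    using k_isCont by (blast intro: continuous_at_imp_continuous_on)
  show 3: "continuous_on S s" for S
    using s_DERIV DERIV_isCont by (blast intro: continuous_at_imp_continuous_on)
  show "continuous_on S (y' n)" "continuous_on S s'"
    unfolding y'_def[abs_def] s'_def[abs_def] by (intro continuous_intros 1 2 3 a_continuous)+
qed

section \<open>The differential equation of the transform\<close>

lemma a_eq: "a j x = - (y j x + (\<Sum>m\<in>UNIV. g j m x * y m x))"
proof -
  have "(mat 1 + G x) *v (- (\<chi> n. y n x)) = (\<chi> n. a n x)"
    unfolding K_vec[symmetric] by (simp add: matrix_vector_mul_assoc K_inverse)
  then have "((mat 1 + G x) *v (- (\<chi> n. y n x))) $ j = a j x" by simp
  then show ?thesis
    by (simp add: matrix_vector_mult_add_rdistrib) (simp add: matrix_vector_mult_def G_def sum_negf)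
qed

lemma k_apply: "(\<Sum>j\<in>UNIV. k n j x * (f j + (\<Sum>m\<in>UNIV. g j m x * f m))) = f n"
proof -
  have "(\<Sum>j\<in>UNIV. k n j x * (\<Sum>m\<in>UNIV. g j m x * f m)) = (\<Sum>j\<in>UNIV. \<Sum>m\<in>UNIV. k n j x * g j m x * f m)"
    by (simp add: sum_distrib_left mult.assoc)
  also have "\<dots> = (\<Sum>m\<in>UNIV. (\<Sum>j\<in>UNIV. k n j x * g j m x) * f m)"
    unfolding sum_distrib_right by (rule sum.swap)
  also have "\<dots> = f n - (\<Sum>m\<in>UNIV. k n m x * f m)"
    unfolding k_g left_diff_distrib sum_subtractf sum_delta_mult ..
  finally show ?thesis
    by (simp add: distrib_left sum.distrib)
qed

text \<open>With L = diag(l) and a = - (I + G) y, the left side K L a + L y collapses to - K (L G -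
  G L) y. The commutator has rank at most two: it is a a'^T - a' a^T by the Wronskian identity, and
  K a = - y.\<close>

lemma spectral_commutator:
  "(\<Sum>j\<in>UNIV. k n j x * (l j * a j x)) + l n * y n x
     = (\<Sum>j\<in>UNIV. y j x * a' j x) * y n x + s x * (\<Sum>j\<in>UNIV. k n j x * a' j x)"
proof -
  let ?T = "\<Sum>m\<in>UNIV. y m x * a' m x"
  have "(\<Sum>j\<in>UNIV. k n j x * (l j * a j x)) + l n * y n x
     = (\<Sum>j\<in>UNIV. k n j x * (l j * a j x)) + (\<Sum>j\<in>UNIV. k n j x * (l j * y j x + (\<Sum>m\<in>UNIV. g j m x * (l m * y m x))))"
    by (simp only: k_apply)
  also have "\<dots> = (\<Sum>j\<in>UNIV. k n j x * (\<Sum>m\<in>UNIV. - ((l j - l m) * g j m x) * y m x))"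
    unfolding sum.distrib[symmetric]
  proof (intro sum.cong refl)
    fix j
    have "l j * a j x + (l j * y j x + (\<Sum>m\<in>UNIV. g j m x * (l m * y m x)))
        = (\<Sum>m\<in>UNIV. - ((l j - l m) * g j m x) * y m x)"
      unfolding a_eq[of j] by (simp add: algebra_simps sum_distrib_left sum_subtractf)
    then show "k n j x * (l j * a j x) + k n j x * (l j * y j x + (\<Sum>m\<in>UNIV. g j m x * (l m * y m x)))
        = k n j x * (\<Sum>m\<in>UNIV. - ((l j - l m) * g j m x) * y m x)"
      unfolding distrib_left[symmetric] by simp
  qed
  also have "\<dots> = (\<Sum>j\<in>UNIV. k n j x * (a' j x * s x - a j x * ?T))"
  proof (intro sum.cong refl)
    fix j
    have "(\<Sum>m\<in>UNIV. - ((l j - l m) * g j m x) * y m x) = (\<Sum>m\<in>UNIV. a' j x * (y m x * a m x) - a j x * (y m x * a' m x))"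
      unfolding g_def wronskian[symmetric] by (intro sum.cong refl) (simp add: algebra_simps)
    also have "\<dots> = a' j x * s x - a j x * ?T"
      by (simp add: sum_subtractf sum_distrib_left s_def)
    finally show "k n j x * (\<Sum>m\<in>UNIV. - ((l j - l m) * g j m x) * y m x) = k n j x * (a' j x * s x - a j x * ?T)"
      by simp
  qed
  also have "\<dots> = ?T * y n x + s x * (\<Sum>j\<in>UNIV. k n j x * a' j x)"
  proof -
    have "(\<Sum>j\<in>UNIV. k n j x * (a' j x * s x - a j x * ?T))
      = s x * (\<Sum>j\<in>UNIV. k n j x * a' j x) - ?T * (\<Sum>j\<in>UNIV. k n j x * a j x)"
      unfolding sum_distrib_left[of "s x"] sum_distrib_left[of ?T] sum_subtractf[symmetric]
      by (intro sum.cong refl) (simp add: right_diff_distrib mult.left_commute mult.commute)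
    then show ?thesis by (simp add: y_def)
  qed
  finally show ?thesis .
qed

text \<open>Differentiating y' = s y - K a' gives (q + s') y + s y' + (y . a') y + K L a with L =
  diag(l). The commutator identity replaces K L a by - l_n y_n + (y . a') y_n + s (K a')_n; since K
  a' = s y - y', the terms s y' cancel, and s^2 + 2 (y . a') supplies the second s'.\<close>

theorem y_solution: "rsol (\<lambda>x. q x + 2 * s' x) (\<lambda>x. l n * y n x) (y n) (y' n)"
  unfolding rsol_def
proof (intro conjI allI y_DERIV)
  let ?D = "\<lambda>x. (s' x * y n x + s x * y' n x)
     - (\<Sum>j\<in>UNIV. - (y n x * y j x) * a' j x + k n j x * (q x * a j x - l j * a j x))"
  have ia: "indef_int (\<lambda>x. q x * a j x - l j * a j x) (a' j)" for j
    using sol by (simp add: rsol_def)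
  have ik: "indef_int (\<lambda>x. - (y n x * y j x)) (k n j)" for j
    by (intro indef_int_DERIV k_DERIV continuous_intros y_continuous)
  have iy: "indef_int (y' n) (y n)" and i_s: "indef_int s' s"
    by (intro indef_int_DERIV y_DERIV s_DERIV y_continuous)+
  have "indef_int ?D (\<lambda>x. s x * y n x - (\<Sum>j\<in>UNIV. k n j x * a' j x))"
    by (intro indef_int_diff indef_int_sum finite indef_int_mult ia ik iy i_s)
  moreover have "?D x = (q x + 2 * s' x) * y n x - l n * y n x" for x
  proof -
    have "(\<Sum>j\<in>UNIV. - (y n x * y j x) * a' j x + k n j x * (q x * a j x - l j * a j x))
      = - y n x * (\<Sum>j\<in>UNIV. y j x * a' j x) + q x * (\<Sum>j\<in>UNIV. k n j x * a j x) - (\<Sum>j\<in>UNIV. k n j x * (l j * a j x))"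
      unfolding sum_distrib_left sum.distrib[symmetric] sum_subtractf[symmetric]
      by (intro sum.cong refl) (simp add: algebra_simps)
    also have "(\<Sum>j\<in>UNIV. k n j x * a j x) = - y n x" by (simp add: y_def)
    also have "(\<Sum>j\<in>UNIV. k n j x * (l j * a j x)) = (\<Sum>j\<in>UNIV. y j x * a' j x) * y n x
        + s x * (\<Sum>j\<in>UNIV. k n j x * a' j x) - l n * y n x"
      using spectral_commutator[of n x] by simp
    finally show ?thesis
      by (simp add: y'_def s'_def power2_eq_square algebra_simps)
  qed
  ultimately show "indef_int (\<lambda>x. (q x + 2 * s' x) * y n x - l n * y n x) (y' n)"
    by (simp add: y'_def[abs_def])
qed

text \<open>K = I - K G, where K is bounded and G tends to 0.\<close>

lemma k_at_bot: "(k i j \<longlongrightarrow> (if i = j then 1 else 0)) at_bot"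
proof -
  have "(g p r \<longlongrightarrow> 0) at_bot" for p r
    unfolding g_def[abs_def] by (intro integral_left_tail(4) L2_left_mult_set_integrable L2)
  then have "((\<lambda>z. (if i = j then 1 else 0) - (\<Sum>p\<in>UNIV. k i p z * g p j z))
      \<longlongrightarrow> (if i = j then 1 else 0) - (\<Sum>p\<in>(UNIV::'n set). 0)) at_bot"
    by (intro tendsto_intros tendsto_bounded_mult_0[OF _ k_bound])
  moreover have "(if i = j then 1 else 0) - (\<Sum>p\<in>UNIV. k i p z * g p j z) = k i j z" for z
    by (simp add: k_g)
  ultimately show ?thesis by simp
qed

text \<open>Row i of (I + G) K = I expresses (1 + g_ii) k_ij through off-diagonal entries times
  bounded entries of K. The product stays bounded while g_ii grows without bound.\<close>

lemma k_at_top: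
  assumes diag: "filterlim (g i i) at_top at_top"
    and off: "\<And>m. m \<noteq> i \<Longrightarrow> \<forall>\<^sub>F x in at_top. \<bar>g i m x\<bar> \<le> B m"
  shows "(k i j \<longlongrightarrow> 0) at_top"
proof -
  define C where "C = 1 + (\<Sum>m\<in>UNIV-{i}. B m)"
  have ev: "\<forall>\<^sub>F x in at_top. \<forall>m\<in>UNIV-{i}. \<bar>g i m x\<bar> \<le> B m"
    using off by (intro eventually_ball_finite) auto
  have pos: "\<forall>\<^sub>F x in at_top. g i i x > 0"
    using diag by (simp add: filterlim_at_top_dense)
  have "\<forall>\<^sub>F x in at_top. norm (k i j x) \<le> C / g i i x"
    using ev pos
  proof eventually_elim
    case (elim x)
    have "(\<Sum>p\<in>UNIV. g i p x * k p j x) = g i i x * k i j x + (\<Sum>p\<in>UNIV-{i}. g i p x * k p j x)"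
      by (subst sum.remove[of UNIV i]) auto
    then have "(1 + g i i x) * k i j x = (if i = j then 1 else 0) - (\<Sum>p\<in>UNIV-{i}. g i p x * k p j x)"
      using k_g(2)[of i x j] by (simp add: distrib_right)
    moreover have "\<bar>\<Sum>p\<in>UNIV-{i}. g i p x * k p j x\<bar> \<le> (\<Sum>m\<in>UNIV-{i}. B m)"
    proof -
      have "\<bar>\<Sum>p\<in>UNIV-{i}. g i p x * k p j x\<bar> \<le> (\<Sum>p\<in>UNIV-{i}. \<bar>g i p x * k p j x\<bar>)"
        by (rule sum_abs)
      also have "\<dots> \<le> (\<Sum>p\<in>UNIV-{i}. B p)"
      proof (rule sum_mono)
        fix p assume "p \<in> UNIV - {i}"
        then have "\<bar>g i p x\<bar> * \<bar>k p j x\<bar> \<le> B p * 1"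
          using elim(1) k_bound[of p j x] by (intro mult_mono) (auto intro: order_trans[OF abs_ge_zero])
        then show "\<bar>g i p x * k p j x\<bar> \<le> B p" by (simp add: abs_mult)
      qed
      finally show ?thesis .
    qed
    ultimately have "\<bar>(1 + g i i x) * k i j x\<bar> \<le> C"
      unfolding C_def by (auto simp: abs_le_iff)
    then have "(1 + g i i x) * \<bar>k i j x\<bar> \<le> C" using elim(2) by (simp add: abs_mult)
    then have "g i i x * \<bar>k i j x\<bar> \<le> C" using abs_ge_zero[of "k i j x"] by (simp add: algebra_simps)
    then show ?case using elim(2) by (simp add: field_simps)
  qed
  moreover have "((\<lambda>x. C / g i i x) \<longlongrightarrow> 0) at_top"
    by (rule real_tendsto_divide_at_top[OF tendsto_const diag])
  ultimately show ?thesis by (rule Lim_null_comparison)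
qed

text \<open>- K is an antiderivative of y y^T. On the diagonal the integrand is nonnegative, so the
  limits of K already give integrability; the squares then dominate the mixed products, and the
  fundamental theorem evaluates all entries as the increment from - I to 0.\<close>

lemma y_mult_integral:
  assumes top: "\<And>m n. (k m n \<longlongrightarrow> 0) at_top"
  shows "integrable lborel (\<lambda>x. y m x * y n x)"
    and "integral\<^sup>L lborel (\<lambda>x. y m x * y n x) = (if m = n then 1 else 0)"
proof -
  have D: "((\<lambda>x. - k m n x) has_real_derivative y m x * y n x) (at x)" for m n x
    using DERIV_minus[OF k_DERIV[of m n x]] by simp
  have c: "isCont (\<lambda>x. y m x * y n x) x" for m n x
    using DERIV_isCont[OF y_DERIV] by (intro continuous_intros)
  have A: "(((\<lambda>x. - k m n x) \<circ> real_of_ereal) \<longlongrightarrow> - (if m = n then 1 else 0)) (at_right (-\<infinity>))"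
    and B: "(((\<lambda>x. - k m n x) \<circ> real_of_ereal) \<longlongrightarrow> - 0) (at_left \<infinity>)" for m n
    unfolding ereal_tendsto_simps1 by (intro tendsto_intros k_at_bot top)+
  have "set_integrable lborel (einterval (-\<infinity>) \<infinity>) (\<lambda>x. y n x * y n x)" for n
    by (rule interval_integral_FTC_nonneg(1)[OF _ D c _ A B]) auto
  then have sq: "integrable lborel (\<lambda>x. y n x * y n x)" for n
    by (simp add: set_integrable_def)
  show i: "integrable lborel (\<lambda>x. y m x * y n x)"
  proof (rule Bochner_Integration.integrable_bound[OF Bochner_Integration.integrable_add[OF sq[of m] sq[of n]]])
    have "y n \<in> borel_measurable borel" for n
      by (rule borel_measurable_continuous_onI[OF y_continuous(1)])
    then show "(\<lambda>x. y m x * y n x) \<in> borel_measurable lborel"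
      by simp
    have "\<bar>u * v\<bar> \<le> u * u + v * v" for u v :: real
      using sum_squares_bound[of "\<bar>u\<bar>" "\<bar>v\<bar>"] mult_nonneg_nonneg[of "\<bar>u\<bar>" "\<bar>v\<bar>"]
      unfolding abs_mult power2_abs power2_eq_square by linarith
    then show "AE x in lborel. norm (y m x * y n x) \<le> norm (y m x * y m x + y n x * y n x)"
      by (intro AE_I2) (auto intro: order_trans[OF _ abs_ge_self])
  qed
  have "(LBINT x=-\<infinity>..\<infinity>. y m x * y n x) = - 0 - - (if m = n then 1 else 0)"
    by (rule interval_integral_FTC_integrable[OF _ _ c _ A B])
       (use D i in \<open>auto simp: set_integrable_def has_real_derivative_iff_has_vector_derivative[symmetric]\<close>)
  then show "integral\<^sup>L lborel (\<lambda>x. y m x * y n x) = (if m = n then 1 else 0)"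
    by (simp add: interval_lebesgue_integral_def set_lebesgue_integral_def)
qed

end

section \<open>The embedded eigenvalues\<close>

lemma rsol_cmult:
  assumes "rsol q h f f'"
  shows "rsol q (\<lambda>x. c * h x) (\<lambda>x. c * f x) (\<lambda>x. c * f' x)"
proof -
  have "rsol q (\<lambda>_. 0) (\<lambda>_. 0) (\<lambda>_. 0)"
    by (simp add: rsol_def indef_int_const)
  from rsol_add_cmult[OF this assms] show ?thesis by simp
qed

text \<open>The derivative and the threshold are bound existentially in one statement, so that they
  can be chosen for all frequencies at once.\<close>

lemma phiN_asymptotics:
  assumes sb: "semibounded q" and q: "loc_integrable q" and "w > 0"
    and J: "jost q \<psi> w" and bv: "\<exists>\<phi>. left_weyl_bv q w \<phi>"
    and u: "is_sol q (complex_of_real (w\<^sup>2)) u" "L2_left u" "u \<noteq> (\<lambda>_. 0)"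
  shows "L2_left (phiN q \<psi> w) \<and> (\<exists>f' X. rsol q (\<lambda>x. w\<^sup>2 * phiN q \<psi> w x) (phiN q \<psi> w) f' \<and>
    (\<forall>x\<ge>X. \<bar>phiN q \<psi> w x\<bar> \<le> 4 \<and> \<bar>f' x\<bar> \<le> 2 * (w + 1) \<and>
      integral {X..x} (\<lambda>s. phiN q \<psi> w s * phiN q \<psi> w s) \<ge> 3/4 * (x - X) - 1/w))"
proof -
  obtain r \<psi>' where r: "norm r = 1" "\<And>x. phiN q \<psi> w x = 2 * Re (r * \<psi> x w)"
    and P: "rsol q (\<lambda>x. w\<^sup>2 * phiN q \<psi> w x) (phiN q \<psi> w) (\<lambda>x. 2 * Re (r * \<psi>' x))"
    and L: "L2_left (phiN q \<psi> w)"
    and lim: "((\<lambda>x. \<psi> x w / cis (w * x)) \<longlongrightarrow> 1) at_top" "((\<lambda>x. \<psi>' x / cis (w * x)) \<longlongrightarrow> \<i> * complex_of_real w) at_top"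
    using phiN_solution[OF sb q \<open>w > 0\<close> J bv u] by blast
  obtain X where "\<And>x. x \<ge> X \<Longrightarrow> \<bar>phiN q \<psi> w x\<bar> \<le> 4" "\<And>x. x \<ge> X \<Longrightarrow> \<bar>2 * Re (r * \<psi>' x)\<bar> \<le> 2 * (w + 1)"
    "\<And>x. x \<ge> X \<Longrightarrow> integral {X..x} (\<lambda>s. phiN q \<psi> w s * phiN q \<psi> w s) \<ge> 3/4 * (x - X) - 1/w"
    using jost_oscillation[OF lim \<open>w > 0\<close> r refl rsol_continuous(1)[OF P]] by blast
  then show ?thesis using L P by blast
qed

context double_commutation
begin

text \<open>For distinct energies the Gram entry is a Wronskian divided by l m - l n, and each of
  the two products in the Wronskian is at most C D.\<close>

lemma g_bounded_off_diagonal: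
  assumes "l m \<noteq> l n"
    and "\<And>x. x \<ge> X \<Longrightarrow> \<bar>a m x\<bar> \<le> C \<and> \<bar>a' m x\<bar> \<le> C" "\<And>x. x \<ge> Y \<Longrightarrow> \<bar>a n x\<bar> \<le> D \<and> \<bar>a' n x\<bar> \<le> D"
  shows "\<forall>\<^sub>F x in at_top. \<bar>g m n x\<bar> \<le> 2 * C * D / \<bar>l m - l n\<bar>"
  using eventually_ge_at_top[of X] eventually_ge_at_top[of Y]
proof eventually_elim
  case (elim x)
  note b = assms(2)[OF elim(1)] assms(3)[OF elim(2)]
  have "\<bar>l m - l n\<bar> * \<bar>g m n x\<bar> = \<bar>a m x * a' n x - a' m x * a n x\<bar>"
    by (simp add: wronskian g_def abs_mult)
  also have "\<dots> \<le> \<bar>a m x\<bar> * \<bar>a' n x\<bar> + \<bar>a' m x\<bar> * \<bar>a n x\<bar>"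
    by (metis abs_mult abs_triangle_ineq4)
  also have "\<dots> \<le> C * D + C * D"
    using b by (intro add_mono mult_mono) auto
  finally show ?case using assms(1) by (simp add: field_simps)
qed

lemma g_diagonal_at_top:
  assumes "c > 0" "\<And>x. x \<ge> X \<Longrightarrow> c * x - d \<le> integral {X..x} (\<lambda>s. a n s * a n s)"
  shows "filterlim (g n n) at_top at_top"
proof -
  let ?w = "\<lambda>s. a n s * a n s"
  have si: "set_integrable lborel {..t} ?w" for t
    by (intro L2_left_mult_set_integrable L2)
  have "\<forall>\<^sub>F x in at_top. c * x - d \<le> g n n x"
    using eventually_ge_at_top[of X]
  proof eventually_elim
    case (elim x)
    have "0 \<le> integral {..X} ?w"
      by (intro Henstock_Kurzweil_Integration.integral_nonneg aa_integrable) auto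
    then show ?case
      using integral_left_tail(3)[of ?w X x, OF si elim] assms(2)[OF elim] by (simp add: g_def)
  qed
  moreover have "filterlim (\<lambda>x. c * x - d) at_top at_top"
    using assms(1) by real_asymp
  ultimately show ?thesis by (rule filterlim_at_top_mono[rotated])
qed

text \<open>By symmetry of I + G the row system is the column system, which is solved uniquely by
  applying K.\<close>

lemma system_iff: "v v* (mat 1 + G x) = - (\<chi> n. a n x) \<longleftrightarrow> v = (\<chi> n. y n x)"
proof -
  have "v v* (mat 1 + G x) = (mat 1 + G x) *v v"
    by (metis IG_transpose transpose_matrix_vector)
  moreover have "(mat 1 + G x) *v (\<chi> n. y n x) = - (\<chi> n. a n x)"
    by (simp add: vec_eq_iff a_eq matrix_vector_mult_add_rdistrib) (simp add: matrix_vector_mult_def G_def)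
  moreover have "v = v'" if "(mat 1 + G x) *v v = (mat 1 + G x) *v v'" for v'
    using arg_cong[OF that, of "\<lambda>v. K x *v v"] by (simp add: matrix_vector_mul_assoc K_inverse)
  ultimately show ?thesis by metis
qed

end

theorem theorem3p1:
  fixes q :: "real \<Rightarrow> real"
    and \<psi> :: "real \<Rightarrow> real \<Rightarrow> complex"
    and \<omega> \<alpha> :: "real^'n"
  assumes locint: "loc_integrable q"
    and sb: "semibounded q"
    and jost_ae: "AE k in lborel. jost q \<psi> k"
    and pos: "\<forall>n. \<omega>$n > 0"
    and distinct: "inj (\<lambda>n. \<omega>$n)"
    and resonance: "\<forall>n. \<exists>u. is_sol q (complex_of_real ((\<omega>$n)\<^sup>2)) u \<and> L2_left u \<and> u \<noteq> (\<lambda>_. 0) \<and>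
        (\<forall>v. is_sol q (complex_of_real ((\<omega>$n)\<^sup>2)) v \<and> L2_left v \<longrightarrow> (\<exists>c. v = (\<lambda>x. c * u x)))"
    and cont: "\<forall>n. \<omega>$n \<in> def_set q \<psi> \<and>
        (\<forall>x. ((\<lambda>k. \<psi> x k) \<longlongrightarrow> \<psi> x (\<omega>$n)) (at (\<omega>$n) within def_set q \<psi>)) \<and>
        (refl q \<psi> \<longlongrightarrow> refl q \<psi> (\<omega>$n)) (at (\<omega>$n) within def_set q \<psi>)"
    and alpha: "\<forall>n. \<alpha>$n \<noteq> 0"
  shows "(\<forall>n. L2_left (phiN q \<psi> (\<omega>$n)))
    \<and> (\<forall>x m n. (\<lambda>s. phiN q \<psi> (\<omega>$m) s * phiN q \<psi> (\<omega>$n) s) integrable_on {..x})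
    \<and> (\<forall>x v. 0 \<le> v \<bullet> (Gplus q \<psi> \<omega> \<alpha> x *v v))
    \<and> (\<forall>n. \<exists>u. u \<noteq> (\<lambda>_. 0) \<and> L2_real u \<and>
          is_sol (qplus q \<psi> \<omega> \<alpha>) (complex_of_real ((\<omega>$n)\<^sup>2)) u)
    \<and> (\<forall>x. \<exists>!yv. yv v* (mat 1 + Gplus q \<psi> \<omega> \<alpha> x) = - (\<chi> n. \<alpha>$n * phiN q \<psi> (\<omega>$n) x))
    \<and> (\<forall>y :: real \<Rightarrow> real^'n.
          (\<forall>x. y x v* (mat 1 + Gplus q \<psi> \<omega> \<alpha> x) = - (\<chi> n. \<alpha>$n * phiN q \<psi> (\<omega>$n) x)) \<longrightarrow>
          (\<forall>n. (\<lambda>x. y x $ n) \<noteq> (\<lambda>_. 0) \<and> L2_real (\<lambda>x. y x $ n) \<and>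
               is_sol (qplus q \<psi> \<omega> \<alpha>) (complex_of_real ((\<omega>$n)\<^sup>2)) (\<lambda>x. complex_of_real (y x $ n))) \<and>
          (\<forall>m n. m \<noteq> n \<longrightarrow> integral\<^sup>L lborel (\<lambda>x. y x $ m * y x $ n) = 0))"
proof -
  let ?\<phi> = "\<lambda>n. phiN q \<psi> (\<omega>$n)"
  define P where "P n f' X \<longleftrightarrow> rsol q (\<lambda>x. (\<omega>$n)\<^sup>2 * ?\<phi> n x) (?\<phi> n) f' \<and>
    (\<forall>x\<ge>X. \<bar>?\<phi> n x\<bar> \<le> 4 \<and> \<bar>f' x\<bar> \<le> 2 * (\<omega>$n + 1) \<and>
      integral {X..x} (\<lambda>s. ?\<phi> n s * ?\<phi> n s) \<ge> 3/4 * (x - X) - 1/\<omega>$n)" for n f' X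
  have main: "L2_left (?\<phi> n) \<and> (\<exists>f' X. P n f' X)" for n
  proof -
    obtain u where "is_sol q (complex_of_real ((\<omega>$n)\<^sup>2)) u" "L2_left u" "u \<noteq> (\<lambda>_. 0)"
      using resonance by blast
    moreover have "jost q \<psi> (\<omega>$n)" "\<exists>\<phi>. left_weyl_bv q (\<omega>$n) \<phi>"
      using cont by (auto simp: def_set_def)
    ultimately show ?thesis
      unfolding P_def using phiN_asymptotics[OF sb locint] pos by blast
  qed
  then have L2\<phi>: "L2_left (?\<phi> n)" for n by blast
  have "\<forall>n. \<exists>f' X. P n f' X" using main by blast
  then obtain f' X where "\<And>n. P n (f' n) (X n)" by metis
  then have sol\<phi>: "\<And>n. rsol q (\<lambda>x. (\<omega>$n)\<^sup>2 * ?\<phi> n x) (?\<phi> n) (f' n)"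
    and X: "\<And>n x. x \<ge> X n \<Longrightarrow> \<bar>?\<phi> n x\<bar> \<le> 4" "\<And>n x. x \<ge> X n \<Longrightarrow> \<bar>f' n x\<bar> \<le> 2 * (\<omega>$n + 1)"
      "\<And>n x. x \<ge> X n \<Longrightarrow> integral {X n..x} (\<lambda>s. ?\<phi> n s * ?\<phi> n s) \<ge> 3/4 * (x - X n) - 1/\<omega>$n"
    unfolding P_def by blast+
  \<comment> \<open>The weights alpha are absorbed into the solutions, so that \<open>Gplus\<close>
    becomes a plain Gram matrix.\<close>
  define a where "a n x = \<alpha>$n * ?\<phi> n x" for n x
  define a' where "a' n x = \<alpha>$n * f' n x" for n x
  define l where "l n = (\<omega>$n)\<^sup>2" for n
  have sol: "rsol q (\<lambda>x. l n * a n x) (a n) (a' n)" for n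
    using rsol_cmult[OF sol\<phi>[of n], of "\<alpha>$n"] unfolding a_def[abs_def] a'_def[abs_def] l_def
    by (simp add: mult.left_commute)
  have L2a: "L2_left (a n)" for n
    unfolding a_def[abs_def] by (rule L2_left_cmult[OF L2\<phi>])
  have ca: "continuous_on UNIV (a n)" for n
    by (rule rsol_continuous(1)[OF sol])
  have wr: "a m x * a' n x - a' m x * a n x = (l m - l n) * integral {..x} (\<lambda>s. a m s * a n s)" for m n x
  proof -
    have "a m x * a' n x - a' m x * a n x = integral {..x} (\<lambda>s. (l m * a m s) * a n s - a m s * (l n * a n s))"
      by (rule wronskian_left[OF sb sol sol]) (intro continuous_intros ca L2a L2_left_cmult)+
    also have "\<dots> = integral {..x} (\<lambda>s. (l m - l n) * (a m s * a n s))"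
      by (simp add: algebra_simps)
    finally show ?thesis by simp
  qed
  interpret double_commutation q l a a'
    by unfold_locales (rule sol, rule L2a, rule wr)
  have Gplus: "Gplus q \<psi> \<omega> \<alpha> x = G x" for x
  proof -
    have "\<alpha>$m * \<alpha>$n * integral {..x} (\<lambda>s. ?\<phi> m s * ?\<phi> n s) = g m n x" for m n
      unfolding g_def a_def integral_mult_right[symmetric] by (simp add: mult.assoc mult.left_commute)
    then show ?thesis by (simp add: Gplus_def G_def)
  qed
  have qplus: "qplus q \<psi> \<omega> \<alpha> = (\<lambda>x. q x + 2 * s' x)"
    unfolding qplus_def[abs_def] Gplus second_log_derivative by simp
  \<comment> \<open>The sum of the bounds 4 and 2 (omega_n + 1) serves for the function and its
    derivative alike.\<close>
  define C where "C n = \<bar>\<alpha>$n\<bar> * (4 + 2 * (\<omega>$n + 1))" for n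
  have bnd: "\<bar>a n x\<bar> \<le> C n \<and> \<bar>a' n x\<bar> \<le> C n" if "x \<ge> X n" for n x
    using X(1,2)[OF that] pos less_imp_le[of 0 "\<omega>$n"] unfolding a_def a'_def C_def abs_mult
    by (auto intro!: mult_left_mono)
  have "l m \<noteq> l n" if "m \<noteq> n" for m n
    using distinct pos that unfolding l_def by (metis injD less_imp_le power2_eq_iff_nonneg)
  then have off: "\<forall>\<^sub>F x in at_top. \<bar>g i m x\<bar> \<le> 2 * C i * C m / \<bar>l i - l m\<bar>" if "m \<noteq> i" for i m
    using g_bounded_off_diagonal[OF _ bnd bnd] that by metis
  have diag: "filterlim (g i i) at_top at_top" for i
  proof (rule g_diagonal_at_top)
    show "0 < (\<alpha>$i)\<^sup>2 * (3/4)" using alpha by simp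
    fix x assume x: "x \<ge> X i"
    \<comment> \<open>The threshold X i and the oscillation term 1/omega_i go into the constant of
      the linear lower bound.\<close>
    have "(\<alpha>$i)\<^sup>2 * (3/4) * x - (\<alpha>$i)\<^sup>2 * (3/4 * X i + 1/\<omega>$i) = (\<alpha>$i)\<^sup>2 * (3/4 * (x - X i) - 1/\<omega>$i)"
      by (simp add: algebra_simps)
    also have "\<dots> \<le> (\<alpha>$i)\<^sup>2 * integral {X i..x} (\<lambda>s. ?\<phi> i s * ?\<phi> i s)"
      by (intro mult_left_mono X(3) x) simp
    also have "\<dots> = integral {X i..x} (\<lambda>s. a i s * a i s)"
      unfolding a_def integral_mult_right[symmetric] by (simp add: power2_eq_square mult.assoc mult.left_commute)
    finally show "(\<alpha>$i)\<^sup>2 * (3/4) * x - (\<alpha>$i)\<^sup>2 * (3/4 * X i + 1/\<omega>$i) \<le> integral {X i..x} (\<lambda>s. a i s * a i s)" .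
  qed
  have top: "(k m n \<longlongrightarrow> 0) at_top" for m n
    by (rule k_at_top[OF diag off])
  note int = y_mult_integral[OF top]
  \<comment> \<open>The square of \<open>y n\<close> integrates to 1 over the line.\<close>
  have nz: "y n \<noteq> (\<lambda>_. 0)" for n
  proof
    assume "y n = (\<lambda>_. 0)"
    then show False using int(2)[of n n] by simp
  qed
  have L2y: "L2_real (y n)" for n
    using int(1)[of n n] borel_measurable_continuous_onI[OF y_continuous(1)]
    by (auto simp: L2_real_def power2_eq_square)
  have L2y': "L2_real (\<lambda>x. complex_of_real (y n x))" for n
    using L2y[of n] by (simp add: L2_real_def borel_measurable_complex_iff[of "\<lambda>x. complex_of_real (y n x)"])
  have soly: "is_sol (qplus q \<psi> \<omega> \<alpha>) (complex_of_real ((\<omega>$n)\<^sup>2)) (\<lambda>x. complex_of_real (y n x))" for n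
    using rsol_csol[OF y_solution[of n]] unfolding qplus is_sol_iff_csol l_def by blast
  have sys: "v v* (mat 1 + Gplus q \<psi> \<omega> \<alpha> x) = - (\<chi> n. \<alpha>$n * ?\<phi> n x) \<longleftrightarrow> v = (\<chi> n. y n x)" for v x
    using system_iff[of v x] unfolding Gplus a_def .
  show ?thesis
  proof (intro conjI allI impI)
    show "(\<lambda>s. ?\<phi> m s * ?\<phi> n s) integrable_on {..x}" for m n x
      by (intro integral_left_tail(1) L2_left_mult_set_integrable L2\<phi>)
    show "0 \<le> v \<bullet> (Gplus q \<psi> \<omega> \<alpha> x *v v)" for v x
      unfolding Gplus by (rule G_psd)
    show "\<exists>u. u \<noteq> (\<lambda>_. 0) \<and> L2_real u \<and> is_sol (qplus q \<psi> \<omega> \<alpha>) (complex_of_real ((\<omega>$n)\<^sup>2)) u" for n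
      using nz[of n] L2y' soly by (intro exI[of _ "\<lambda>x. complex_of_real (y n x)"]) (auto simp: fun_eq_iff)
    show "\<exists>!yv. yv v* (mat 1 + Gplus q \<psi> \<omega> \<alpha> x) = - (\<chi> n. \<alpha>$n * ?\<phi> n x)" for x
      unfolding sys by simp
    fix z :: "real \<Rightarrow> real^'n"
    assume "\<forall>x. z x v* (mat 1 + Gplus q \<psi> \<omega> \<alpha> x) = - (\<chi> n. \<alpha>$n * ?\<phi> n x)"
    then have z: "z x $ n = y n x" for x n
      unfolding sys by simp
    show "(\<lambda>x. z x $ n) \<noteq> (\<lambda>_. 0)" "L2_real (\<lambda>x. z x $ n)"
      "is_sol (qplus q \<psi> \<omega> \<alpha>) (complex_of_real ((\<omega>$n)\<^sup>2)) (\<lambda>x. complex_of_real (z x $ n))" for n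
      unfolding z using nz L2y soly by blast+
    show "integral\<^sup>L lborel (\<lambda>x. z x $ m * z x $ n) = 0" if "m \<noteq> n" for m n
      unfolding z using int(2)[of m n] that by simp
  qed (rule L2\<phi>)
qed

end
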